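(* Let $f:M^n\to\mathbb{S}_1^{n+1}(\kappa)$ be a semi-parallel spacelike immersion. If $f$ is extremal, then $f$ is totally geodesic.
   Context: $\mathbb{S}_1^{n+1}(\kappa)$, $\kappa>0$, is the $(n+1)$-dimensional de Sitter space, i.e. the Lorentzian (index $1$) sphere of constant curvature $\kappa$. $f$ is spacelike if the induced metric on $M$ is positive definite. $\alpha$ is the second fundamental form of $f$; $f$ is extremal if its mean curvature vector field $\vec H=\frac1n\mathrm{tr}(\alpha)$ vanishes identically, and totally geodesic if $\alpha=0$. $f$ is semi-parallel if $(\overline R(X,Y)\cdot\alpha)(Z,W)=0$ for all tangent $X,Y,Z,W$, where $(\overline R(X,Y)\cdot\alpha)(Z,W)=R^\perp(X,Y)\alpha(Z,W)-\alpha(R(X,Y)Z,W)-\alpha(Z,R(X,Y)W)$ with $R,R^\perp$ the curvature tensors of $TM$ and $TM^\perp$. *)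

theory Defs
  imports "HOL-Analysis.Analysis"
begin

section \<open>Smoothness and smooth manifolds\<close>

text \<open>Both definitions are meant for open \<open>S\<close>.\<close>

fun Ck_on :: "nat \<Rightarrow> ('a::euclidean_space \<Rightarrow> 'b::euclidean_space) \<Rightarrow> 'a set \<Rightarrow> bool" where
  "Ck_on 0 h S \<longleftrightarrow> continuous_on S h"
| "Ck_on (Suc k) h S \<longleftrightarrow> (\<forall>x\<in>S. h differentiable (at x)) \<and>
     (\<forall>v. Ck_on k (\<lambda>x. frechet_derivative h (at x) v) S)"

definition smooth_on :: "'a set \<Rightarrow> ('a::euclidean_space \<Rightarrow> 'b::euclidean_space) \<Rightarrow> bool" where
  "smooth_on S h \<longleftrightarrow> (\<forall>k. Ck_on k h S)"

text \<open>A chart is a pair \<open>(U, \<phi>)\<close>; the dimension of the manifold is \<open>DIM('e)\<close>.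
  Only the values of \<open>\<phi>\<close> on \<open>U\<close> matter.\<close>

definition smooth_manifold :: "'m topology \<Rightarrow> ('m set \<times> ('m \<Rightarrow> 'e::euclidean_space)) set \<Rightarrow> bool" where
  "smooth_manifold M \<A> \<longleftrightarrow>
     Hausdorff_space M \<and> second_countable M \<and>
     topspace M = (\<Union>(U, \<phi>)\<in>\<A>. U) \<and>
     (\<forall>(U, \<phi>)\<in>\<A>. openin M U \<and> open (\<phi> ` U) \<and>
        homeomorphic_map (subtopology M U) (top_of_set (\<phi> ` U)) \<phi>) \<and>
     (\<forall>(U, \<phi>)\<in>\<A>. \<forall>(V, \<psi>)\<in>\<A>. smooth_on (\<phi> ` (U \<inter> V)) (\<psi> \<circ> inv_into U \<phi>))"

section \<open>De Sitter space as a hyperquadric in Minkowski space\<close>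

definition lorentz :: "real \<times> 'b::euclidean_space \<Rightarrow> real \<times> 'b \<Rightarrow> real" where
  "lorentz v w = snd v \<bullet> snd w - fst v * fst w"

text \<open>This is the Lorentzian sphere of curvature \<open>\<kappa>\<close>, of dimension \<open>DIM('b)\<close>; its metric is the
  restriction of \<open>lorentz\<close>, and its tangent space at \<open>p\<close> is the \<open>lorentz\<close>-orthogonal complement
  of \<open>p\<close>.\<close>

definition de_sitter :: "real \<Rightarrow> (real \<times> 'b::euclidean_space) set" where
  "de_sitter \<kappa> = {p. lorentz p p = 1 / \<kappa>}"

section \<open>Local geometry of a spacelike immersion\<close>

text \<open>Throughout, \<open>F\<close> is an immersion of an open subset of \<open>'e\<close> into \<open>de_sitter \<kappa>\<close> (later:
  an immersion of a manifold, read in a chart), \<open>X\<close>, \<open>Y\<close>, \<open>Z\<close>, \<open>W\<close> are vector fields in the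
  domain of \<open>F\<close>, and \<open>V\<close> is a vector field along \<open>F\<close>. All operators below only depend on the
  germs of their arguments at the point \<open>u\<close>.\<close>

definition dir_deriv :: "('a::euclidean_space \<Rightarrow> 'a) \<Rightarrow> ('a \<Rightarrow> 'b::euclidean_space) \<Rightarrow> 'a \<Rightarrow> 'b" where
  "dir_deriv X h u = frechet_derivative h (at u) (X u)"

definition lie_bracket :: "('a::euclidean_space \<Rightarrow> 'a) \<Rightarrow> ('a \<Rightarrow> 'a) \<Rightarrow> 'a \<Rightarrow> 'a" where
  "lie_bracket X Y u = dir_deriv X Y u - dir_deriv Y X u"

definition curvature ::
  "(('a::euclidean_space \<Rightarrow> 'a) \<Rightarrow> ('a \<Rightarrow> 'b::euclidean_space) \<Rightarrow> 'a \<Rightarrow> 'b) \<Rightarrow>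
   ('a \<Rightarrow> 'a) \<Rightarrow> ('a \<Rightarrow> 'a) \<Rightarrow> ('a \<Rightarrow> 'b) \<Rightarrow> 'a \<Rightarrow> 'b" where
  "curvature nabla X Y s u =
     nabla X (nabla Y s) u - nabla Y (nabla X s) u - nabla (lie_bracket X Y) s u"

definition induced_metric ::
  "('e::euclidean_space \<Rightarrow> real \<times> 'b::euclidean_space) \<Rightarrow> 'e \<Rightarrow> 'e \<Rightarrow> 'e \<Rightarrow> real" where
  "induced_metric F u v w =
     lorentz (frechet_derivative F (at u) v) (frechet_derivative F (at u) w)"

text \<open>The Levi-Civita connection of the induced metric, given by the Koszul formula. It suffices to
  test against the constant vector fields \<open>\<lambda>_. z\<close>.\<close>

definition levi_civita ::
  "('e::euclidean_space \<Rightarrow> real \<times> 'b::euclidean_space) \<Rightarrow> ('e \<Rightarrow> 'e) \<Rightarrow> ('e \<Rightarrow> 'e) \<Rightarrow> 'e \<Rightarrow> 'e" where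
  "levi_civita F X Y u =
     (let g = (\<lambda>X Y u. induced_metric F u (X u) (Y u)) in
      THE v. \<forall>z. let Z = (\<lambda>_. z) in
        2 * induced_metric F u v z =
          dir_deriv X (g Y Z) u + dir_deriv Y (g X Z) u - dir_deriv Z (g X Y) u
          + g (lie_bracket X Y) Z u - g (lie_bracket X Z) Y u - g (lie_bracket Y Z) X u)"

text \<open>The Levi-Civita connection of de Sitter space, pulled back along \<open>F\<close>: the component of the
  flat derivative tangent to the hyperquadric, whose normal at \<open>F u\<close> is \<open>F u\<close> itself, with
  \<open>lorentz (F u) (F u) = 1 / \<kappa>\<close>.\<close>

definition ambient_conn ::
  "real \<Rightarrow> ('e::euclidean_space \<Rightarrow> real \<times> 'b::euclidean_space) \<Rightarrow>
   ('e \<Rightarrow> 'e) \<Rightarrow> ('e \<Rightarrow> real \<times> 'b) \<Rightarrow> 'e \<Rightarrow> real \<times> 'b" where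
  "ambient_conn \<kappa> F X V u = dir_deriv X V u - (\<kappa> * lorentz (dir_deriv X V u) (F u)) *\<^sub>R F u"

text \<open>The normal space is taken inside the tangent space of de Sitter space.\<close>

definition normal_space ::
  "('e::euclidean_space \<Rightarrow> real \<times> 'b::euclidean_space) \<Rightarrow> 'e \<Rightarrow> (real \<times> 'b) set" where
  "normal_space F u =
     {w. lorentz w (F u) = 0 \<and> (\<forall>z. lorentz w (frechet_derivative F (at u) z) = 0)}"

definition normal_part ::
  "('e::euclidean_space \<Rightarrow> real \<times> 'b::euclidean_space) \<Rightarrow> 'e \<Rightarrow> real \<times> 'b \<Rightarrow> real \<times> 'b" where
  "normal_part F u v =
     (THE w. w \<in> normal_space F u \<and> v - w \<in> range (frechet_derivative F (at u)))"

definition normal_conn ::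
  "real \<Rightarrow> ('e::euclidean_space \<Rightarrow> real \<times> 'b::euclidean_space) \<Rightarrow>
   ('e \<Rightarrow> 'e) \<Rightarrow> ('e \<Rightarrow> real \<times> 'b) \<Rightarrow> 'e \<Rightarrow> real \<times> 'b" where
  "normal_conn \<kappa> F X \<xi> u = normal_part F u (ambient_conn \<kappa> F X \<xi> u)"

text \<open>The field \<open>dir_deriv Y F\<close> along \<open>F\<close> is the push-forward of \<open>Y\<close>.\<close>

definition second_fundamental_form ::
  "real \<Rightarrow> ('e::euclidean_space \<Rightarrow> real \<times> 'b::euclidean_space) \<Rightarrow>
   ('e \<Rightarrow> 'e) \<Rightarrow> ('e \<Rightarrow> 'e) \<Rightarrow> 'e \<Rightarrow> real \<times> 'b" where
  "second_fundamental_form \<kappa> F X Y u = normal_part F u (ambient_conn \<kappa> F X (dir_deriv Y F) u)"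

text \<open>The derivation \<open>(R\<^bsub>XY\<^esub> \<cdot> \<alpha>)(Z, W)\<close> of the second fundamental form \<open>\<alpha>\<close>.\<close>

definition curvature_action ::
  "real \<Rightarrow> ('e::euclidean_space \<Rightarrow> real \<times> 'b::euclidean_space) \<Rightarrow>
   ('e \<Rightarrow> 'e) \<Rightarrow> ('e \<Rightarrow> 'e) \<Rightarrow> ('e \<Rightarrow> 'e) \<Rightarrow> ('e \<Rightarrow> 'e) \<Rightarrow> 'e \<Rightarrow> real \<times> 'b" where
  "curvature_action \<kappa> F X Y Z W u =
     (let \<alpha> = second_fundamental_form \<kappa> F; R = curvature (levi_civita F) in
      curvature (normal_conn \<kappa> F) X Y (\<alpha> Z W) u - \<alpha> (R X Y Z) W u - \<alpha> Z (R X Y W) u)"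

definition orthonormal_basis ::
  "('e::euclidean_space \<Rightarrow> real \<times> 'b::euclidean_space) \<Rightarrow> 'e \<Rightarrow> 'e set \<Rightarrow> bool" where
  "orthonormal_basis F u B \<longleftrightarrow> finite B \<and> span B = UNIV \<and>
     (\<forall>b\<in>B. \<forall>c\<in>B. induced_metric F u b c = (if b = c then 1 else 0))"

text \<open>The trace does not depend on the orthonormal basis chosen. Since the second fundamental form
  is tensorial, vectors may be extended to constant fields.\<close>

definition mean_curvature ::
  "real \<Rightarrow> ('e::euclidean_space \<Rightarrow> real \<times> 'b::euclidean_space) \<Rightarrow> 'e \<Rightarrow> real \<times> 'b" where
  "mean_curvature \<kappa> F u = (1 / real DIM('e)) *\<^sub>R
     (\<Sum>b\<in>(SOME B. orthonormal_basis F u B). second_fundamental_form \<kappa> F (\<lambda>_. b) (\<lambda>_. b) u)"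

section \<open>Global notions for a map on a manifold\<close>

text \<open>The map \<open>f\<close> read in the chart \<open>(U, \<phi>)\<close>, with domain \<open>\<phi> ` U\<close>. The notions below are tensorial, so
  that vector fields on chart domains suffice, and invariant under change of charts.\<close>

definition local_rep :: "'m set \<Rightarrow> ('m \<Rightarrow> 'e) \<Rightarrow> ('m \<Rightarrow> 'c) \<Rightarrow> 'e \<Rightarrow> 'c" where
  "local_rep U \<phi> f = f \<circ> inv_into U \<phi>"

definition smooth_map_into ::
  "'m topology \<Rightarrow> ('m set \<times> ('m \<Rightarrow> 'e::euclidean_space)) set \<Rightarrow>
   (real \<times> 'b::euclidean_space) set \<Rightarrow> ('m \<Rightarrow> real \<times> 'b) \<Rightarrow> bool" where
  "smooth_map_into M \<A> S f \<longleftrightarrow> f \<in> topspace M \<rightarrow> S \<and>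
     (\<forall>(U, \<phi>)\<in>\<A>. smooth_on (\<phi> ` U) (local_rep U \<phi> f))"

definition immersion ::
  "('m set \<times> ('m \<Rightarrow> 'e::euclidean_space)) set \<Rightarrow> ('m \<Rightarrow> real \<times> 'b::euclidean_space) \<Rightarrow> bool" where
  "immersion \<A> f \<longleftrightarrow>
     (\<forall>(U, \<phi>)\<in>\<A>. \<forall>u\<in>\<phi> ` U. inj (frechet_derivative (local_rep U \<phi> f) (at u)))"

definition spacelike ::
  "('m set \<times> ('m \<Rightarrow> 'e::euclidean_space)) set \<Rightarrow> ('m \<Rightarrow> real \<times> 'b::euclidean_space) \<Rightarrow> bool" where
  "spacelike \<A> f \<longleftrightarrow>
     (\<forall>(U, \<phi>)\<in>\<A>. \<forall>u\<in>\<phi> ` U. \<forall>v. v \<noteq> 0 \<longrightarrow> induced_metric (local_rep U \<phi> f) u v v > 0)"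

definition spacelike_immersion_de_sitter ::
  "real \<Rightarrow> 'm topology \<Rightarrow> ('m set \<times> ('m \<Rightarrow> 'e::euclidean_space)) set \<Rightarrow>
   ('m \<Rightarrow> real \<times> 'b::euclidean_space) \<Rightarrow> bool" where
  "spacelike_immersion_de_sitter \<kappa> M \<A> f \<longleftrightarrow>
     smooth_map_into M \<A> (de_sitter \<kappa>) f \<and> immersion \<A> f \<and> spacelike \<A> f"

definition semi_parallel ::
  "real \<Rightarrow> ('m set \<times> ('m \<Rightarrow> 'e::euclidean_space)) set \<Rightarrow>
   ('m \<Rightarrow> real \<times> 'b::euclidean_space) \<Rightarrow> bool" where
  "semi_parallel \<kappa> \<A> f \<longleftrightarrow>
     (\<forall>(U, \<phi>)\<in>\<A>. \<forall>X Y Z W. smooth_on (\<phi> ` U) X \<longrightarrow> smooth_on (\<phi> ` U) Y \<longrightarrow>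
        smooth_on (\<phi> ` U) Z \<longrightarrow> smooth_on (\<phi> ` U) W \<longrightarrow>
        (\<forall>u\<in>\<phi> ` U. curvature_action \<kappa> (local_rep U \<phi> f) X Y Z W u = 0))"

definition extremal ::
  "real \<Rightarrow> ('m set \<times> ('m \<Rightarrow> 'e::euclidean_space)) set \<Rightarrow>
   ('m \<Rightarrow> real \<times> 'b::euclidean_space) \<Rightarrow> bool" where
  "extremal \<kappa> \<A> f \<longleftrightarrow>
     (\<forall>(U, \<phi>)\<in>\<A>. \<forall>u\<in>\<phi> ` U. mean_curvature \<kappa> (local_rep U \<phi> f) u = 0)"

definition totally_geodesic ::
  "real \<Rightarrow> ('m set \<times> ('m \<Rightarrow> 'e::euclidean_space)) set \<Rightarrow>
   ('m \<Rightarrow> real \<times> 'b::euclidean_space) \<Rightarrow> bool" where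
  "totally_geodesic \<kappa> \<A> f \<longleftrightarrow>
     (\<forall>(U, \<phi>)\<in>\<A>. \<forall>X Y. smooth_on (\<phi> ` U) X \<longrightarrow> smooth_on (\<phi> ` U) Y \<longrightarrow>
        (\<forall>u\<in>\<phi> ` U. second_fundamental_form \<kappa> (local_rep U \<phi> f) X Y u = 0))"

end

theory Submission
  imports Defs
begin

text \<open>
  Locally the hypersurface has a normal direction \<open>\<nu>\<close>, and its second fundamental form is \<open>h \<nu>\<close>
  for a real symmetric form \<open>h\<close>. Three facts determine \<open>h\<close>. The normal direction is timelike,
  because the tangent space is spacelike and the ambient space has index one. The normal bundle is
  a line bundle, so its curvature vanishes (\<open>normal_curvature_zero\<close>) and the semi-parallel condition
  reduces to \<open>h(R(x,y)z, w) + h(z, R(x,y)w) = 0\<close>. The Gauss equation (\<open>gauss_equation\<close>)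
  expresses \<open>R\<close> by the metric and \<open>h\<close>; with \<open>q < 0\<close> the square length of \<open>\<nu>\<close>,
  \<open>g(R(x,y)z, w) = \<kappa> (g(y,z) g(x,w) - g(x,z) g(y,w)) + q (h(y,z) h(x,w) - h(x,z) h(y,w))\<close>.

  In a basis of eigenvectors of the shape operator, with eigenvalues \<open>\<lambda>\<^sub>i\<close> for \<open>q = -1\<close>, the condition
  says \<open>(\<kappa> - \<lambda>\<^sub>i \<lambda>\<^sub>j) (\<lambda>\<^sub>i - \<lambda>\<^sub>j) = 0\<close>. If the trace is zero and some eigenvalue is not, then there are
  eigenvalues of opposite signs, for which both factors are nonzero, a contradiction.
  The proof below reaches the same conclusion without diagonalization: contracting the condition over
  an orthonormal basis of the \<open>n\<close>-dimensional tangent space and using that \<open>h\<close> is traceless gives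
  \<open>(\<kappa> n - q |h|\<^sup>2) h = 0\<close>, whose first factor is positive
  (\<open>traceless_semi_symmetric_form_zero\<close>).

  The differential geometry is done extrinsically, with flat derivatives in Minkowski space. The
  Levi-Civita connection, the second fundamental form and the normal connection are the tangential
  and normal parts of flat derivatives (\<open>levi_civita_eq\<close>, \<open>second_fundamental_form_eq\<close>,
  \<open>normal_conn_eq\<close>), and the equations of Gauss and Ricci are the tangential and normal parts of the
  symmetry of second derivatives. Curvature differentiates these parts again, so they must depend
  smoothly on the base point. Tangential parts solve a linear system with the Gram matrix, and the
  solution of a linear system with smooth coefficients is smooth (\<open>smooth_on_linear_solution\<close>).
\<close>

section \<open>Smooth maps and directional derivatives\<close>

lemma Ck_on_cong:
  assumes "open S" "\<And>x. x \<in> S \<Longrightarrow> f x = g x" "Ck_on k f S"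
  shows "Ck_on k g S"
  using assms(2,3)
proof (induction k arbitrary: f g)
  case 0
  then show ?case
    by (metis Ck_on.simps(1) continuous_on_cong)
next
  case (Suc k)
  have d: "(g has_derivative frechet_derivative f (at x)) (at x)" if "x \<in> S" for x
    using Suc.prems that assms(1)
    by (metis Ck_on.simps(2) frechet_derivative_works has_derivative_transform_within_open)
  have "Ck_on k (\<lambda>x. frechet_derivative g (at x) v) S" for v
    by (rule Suc.IH[of "\<lambda>x. frechet_derivative f (at x) v"])
      (use d Suc.prems frechet_derivative_at in \<open>fastforce+\<close>)
  then show ?case
    using d differentiable_def by fastforce
qed

lemma Ck_on_SucI:
  assumes "open S"
    and "\<And>x. x \<in> S \<Longrightarrow> (f has_derivative f' x) (at x)"
    and "\<And>v. Ck_on k (\<lambda>x. f' x v) S"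
  shows "Ck_on (Suc k) f S"
proof -
  have "Ck_on k (\<lambda>x. frechet_derivative f (at x) v) S" for v
    by (rule Ck_on_cong[OF assms(1) _ assms(3)[of v]])
      (metis assms(2) frechet_derivative_at)
  then show ?thesis
    using assms(2) differentiable_def by fastforce
qed

lemma Ck_on_has_derivative:
  "Ck_on (Suc k) f S \<Longrightarrow> x \<in> S \<Longrightarrow> (f has_derivative frechet_derivative f (at x)) (at x)"
  using frechet_derivative_works by auto

lemma Ck_on_Suc_imp: "Ck_on (Suc k) f S \<Longrightarrow> Ck_on k f S"
proof (induction k arbitrary: f)
  case 0
  then show ?case
    by (auto simp: continuous_on_eq_continuous_within
        intro: differentiable_imp_continuous_within differentiable_at_withinI)
next
  case (Suc k)
  then show ?case by (metis Ck_on.simps(2))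
qed

lemma Ck_on_const: "Ck_on k (\<lambda>_. c) S"
  by (induction k arbitrary: c) auto

lemma Ck_on_add:
  assumes "open S" "Ck_on k f S" "Ck_on k g S"
  shows "Ck_on k (\<lambda>x. f x + g x) S"
  using assms(2,3)
proof (induction k arbitrary: f g)
  case 0
  then show ?case by (simp add: continuous_on_add)
next
  case (Suc k)
  show ?case
    by (rule Ck_on_SucI[OF assms(1) has_derivative_add[OF Ck_on_has_derivative[OF Suc.prems(1)]
            Ck_on_has_derivative[OF Suc.prems(2)]]])
      (use Suc in auto)
qed

lemma Ck_on_bilinear:
  assumes B: "bounded_bilinear B" and "open S" "Ck_on k f S" "Ck_on k g S"
  shows "Ck_on k (\<lambda>x. B (f x) (g x)) S"
  using assms(3,4)
proof (induction k arbitrary: f g)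
  case 0
  then show ?case by (simp add: bounded_bilinear.continuous_on[OF B])
next
  case (Suc k)
  have "Ck_on k (\<lambda>x. frechet_derivative f (at x) v) S"
    "Ck_on k (\<lambda>x. frechet_derivative g (at x) v) S" for v
    using Suc.prems by simp_all
  moreover have "Ck_on k f S" "Ck_on k g S"
    using Suc.prems by (blast intro: Ck_on_Suc_imp)+
  ultimately show ?case
    by (intro Ck_on_SucI[OF assms(2) bounded_bilinear.FDERIV[OF B Ck_on_has_derivative[OF Suc.prems(1)]
            Ck_on_has_derivative[OF Suc.prems(2)]]]
        Ck_on_add Suc.IH assms(2))
qed

lemma smooth_onD: "smooth_on S f \<Longrightarrow> x \<in> S \<Longrightarrow> f differentiable (at x)"
  unfolding smooth_on_def by (metis Ck_on.simps(2))

lemma smooth_on_cong: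
  "open S \<Longrightarrow> (\<And>x. x \<in> S \<Longrightarrow> f x = g x) \<Longrightarrow> smooth_on S f \<Longrightarrow> smooth_on S g"
  unfolding smooth_on_def using Ck_on_cong by metis

lemma smooth_on_const [simp]: "smooth_on S (\<lambda>_. c)"
  by (simp add: smooth_on_def Ck_on_const)

lemma smooth_on_add:
  "open S \<Longrightarrow> smooth_on S f \<Longrightarrow> smooth_on S g \<Longrightarrow> smooth_on S (\<lambda>x. f x + g x)"
  by (simp add: smooth_on_def Ck_on_add)

lemma smooth_on_bilinear:
  assumes "bounded_bilinear B" "open S" "smooth_on S f" "smooth_on S g"
  shows "smooth_on S (\<lambda>x. B (f x) (g x))"
  using assms by (simp add: smooth_on_def Ck_on_bilinear)

lemmas smooth_on_scaleR = smooth_on_bilinear[OF bounded_bilinear_scaleR]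
lemmas smooth_on_inner = smooth_on_bilinear[OF bounded_bilinear_inner]

lemma smooth_on_diff:
  assumes "open S" "smooth_on S f" "smooth_on S g"
  shows "smooth_on S (\<lambda>x. f x - g x)"
  using smooth_on_add[OF assms(1,2) smooth_on_scaleR[OF assms(1) smooth_on_const[of S "-1"] assms(3)]]
  by simp

lemma smooth_on_sum:
  assumes "open S" "\<And>i. i \<in> I \<Longrightarrow> smooth_on S (f i)"
  shows "smooth_on S (\<lambda>x. \<Sum>i\<in>I. f i x)"
  using assms(2)
  by (induction I rule: infinite_finite_induct) (auto intro: smooth_on_add[OF assms(1)])

lemma smooth_on_frechet_derivative:
  "smooth_on S f \<Longrightarrow> smooth_on S (\<lambda>x. frechet_derivative f (at x) v)"
  unfolding smooth_on_def by (metis Ck_on.simps(2))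

lemma linear_eq_sum_Basis:
  fixes l :: "'a::euclidean_space \<Rightarrow> 'b::real_vector"
  assumes "linear l"
  shows "l v = (\<Sum>b\<in>Basis. (v \<bullet> b) *\<^sub>R l b)"
proof -
  have "l v = l (\<Sum>b\<in>Basis. (v \<bullet> b) *\<^sub>R b)"
    by (simp add: euclidean_representation)
  then show ?thesis
    by (simp add: linear_sum[OF assms] linear_cmul[OF assms])
qed

lemma dir_deriv_eq_sum_Basis:
  assumes "f differentiable (at u)"
  shows "dir_deriv X f u = (\<Sum>b\<in>Basis. (X u \<bullet> b) *\<^sub>R frechet_derivative f (at u) b)"
  unfolding dir_deriv_def by (rule linear_eq_sum_Basis[OF linear_frechet_derivative[OF assms]])

lemma smooth_on_dir_deriv:
  assumes "open S" "smooth_on S X" "smooth_on S f"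
  shows "smooth_on S (dir_deriv X f)"
proof (rule smooth_on_cong[OF assms(1) dir_deriv_eq_sum_Basis[symmetric]])
  show "smooth_on S (\<lambda>u. \<Sum>b\<in>Basis. (X u \<bullet> b) *\<^sub>R frechet_derivative f (at u) b)"
    by (intro smooth_on_sum smooth_on_scaleR smooth_on_inner smooth_on_frechet_derivative
        smooth_on_const assms)
qed (use assms smooth_onD in blast)

lemma dir_deriv_cong:
  assumes "open S" "u \<in> S" "f differentiable (at u)" "\<And>x. x \<in> S \<Longrightarrow> f x = g x"
  shows "dir_deriv X f u = dir_deriv X g u"
  unfolding dir_deriv_def
  by (metis assms frechet_derivative_transform_within_open)

lemma dir_deriv_has_derivative:
  "(f has_derivative f') (at u) \<Longrightarrow> dir_deriv X f u = f' (X u)"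
  unfolding dir_deriv_def by (metis frechet_derivative_at)

lemma dir_deriv_const [simp]: "dir_deriv X (\<lambda>_. c) u = 0"
  by (simp add: dir_deriv_def)

lemma dir_deriv_add:
  assumes "f differentiable (at u)" "g differentiable (at u)"
  shows "dir_deriv X (\<lambda>u. f u + g u) u = dir_deriv X f u + dir_deriv X g u"
  unfolding dir_deriv_def[of X f] dir_deriv_def[of X g]
  using assms by (intro dir_deriv_has_derivative has_derivative_add) (simp_all flip: frechet_derivative_works)

lemma dir_deriv_sum:
  assumes "\<And>i. i \<in> I \<Longrightarrow> f i differentiable (at u)"
  shows "dir_deriv X (\<lambda>u. \<Sum>i\<in>I. f i u) u = (\<Sum>i\<in>I. dir_deriv X (f i) u)"
  unfolding dir_deriv_def[of X "f _"]
  using assms by (intro dir_deriv_has_derivative has_derivative_sum) (simp_all flip: frechet_derivative_works)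

lemma dir_deriv_bilinear:
  assumes "bounded_bilinear B" "f differentiable (at u)" "g differentiable (at u)"
  shows "dir_deriv X (\<lambda>u. B (f u) (g u)) u = B (f u) (dir_deriv X g u) + B (dir_deriv X f u) (g u)"
  unfolding dir_deriv_def[of X f] dir_deriv_def[of X g]
  using assms by (intro dir_deriv_has_derivative bounded_bilinear.FDERIV) (simp_all flip: frechet_derivative_works)

section \<open>Symmetry of second derivatives\<close>

text \<open>Two applications of the mean value theorem turn the second difference of \<open>h\<close> over a small
  parallelogram into a mixed derivative at one of its points. The second difference is symmetric
  in the two sides; this is why mixed derivatives commute.\<close>

lemma second_difference_mvt:
  fixes h :: "'a::euclidean_space \<Rightarrow> real"
  assumes r: "0 < r" and S: "\<And>a b. 0 \<le> a \<Longrightarrow> a \<le> r \<Longrightarrow> 0 \<le> b \<Longrightarrow> b \<le> r \<Longrightarrow> u + a *\<^sub>R x + b *\<^sub>R y \<in> S"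
    and h: "\<And>p. p \<in> S \<Longrightarrow> h differentiable (at p)"
    and hx: "\<And>p. p \<in> S \<Longrightarrow> (\<lambda>p. frechet_derivative h (at p) x) differentiable (at p)"
  obtains a b where "0 < a" "a < r" "0 < b" "b < r"
    "h (u + r *\<^sub>R x + r *\<^sub>R y) - h (u + r *\<^sub>R x) - h (u + r *\<^sub>R y) + h u =
      r\<^sup>2 * frechet_derivative (\<lambda>p. frechet_derivative h (at p) x) (at (u + a *\<^sub>R x + b *\<^sub>R y)) y"
proof -
  have deriv_line: "((\<lambda>t. k (p + t *\<^sub>R v)) has_real_derivative frechet_derivative k (at (p + t *\<^sub>R v)) v) (at t)"
    if "k differentiable (at (p + t *\<^sub>R v))" for k :: "'a \<Rightarrow> real" and p v t
  proof -
    have lin: "linear (frechet_derivative k (at (p + t *\<^sub>R v)))"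
      using that by (rule linear_frechet_derivative)
    have "((\<lambda>t. p + t *\<^sub>R v) has_derivative (\<lambda>s. s *\<^sub>R v)) (at t)"
      by (auto intro!: derivative_eq_intros)
    from diff_chain_at[OF this that[unfolded frechet_derivative_works]]
    have "((\<lambda>t. k (p + t *\<^sub>R v)) has_derivative (\<lambda>s. frechet_derivative k (at (p + t *\<^sub>R v)) (s *\<^sub>R v))) (at t)"
      by (simp add: o_def)
    then show ?thesis
      unfolding has_field_derivative_def
      by (rule has_derivative_eq_rhs) (auto simp: linear_cmul[OF lin] mult.commute)
  qed
  define \<phi> where "\<phi> = (\<lambda>a. h ((u + r *\<^sub>R y) + a *\<^sub>R x) - h (u + a *\<^sub>R x))"
  have "\<exists>a>0. a < r \<and> \<phi> r - \<phi> 0 = (r - 0) * (frechet_derivative h (at ((u + r *\<^sub>R y) + a *\<^sub>R x)) x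
      - frechet_derivative h (at (u + a *\<^sub>R x)) x)"
    unfolding \<phi>_def
  proof (rule MVT2[OF r])
    fix a assume a: "0 \<le> a" "a \<le> r"
    show "((\<lambda>a. h ((u + r *\<^sub>R y) + a *\<^sub>R x) - h (u + a *\<^sub>R x)) has_real_derivative
      frechet_derivative h (at ((u + r *\<^sub>R y) + a *\<^sub>R x)) x - frechet_derivative h (at (u + a *\<^sub>R x)) x) (at a)"
      using S[OF a, of r] S[OF a, of 0] r
      by (intro DERIV_diff deriv_line h) (auto simp: algebra_simps)
  qed
  then obtain a where a: "0 < a" "a < r"
    and eq1: "\<phi> r - \<phi> 0 = r * (frechet_derivative h (at ((u + r *\<^sub>R y) + a *\<^sub>R x)) x
      - frechet_derivative h (at (u + a *\<^sub>R x)) x)"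
    by auto
  define \<psi> where "\<psi> = (\<lambda>b. frechet_derivative h (at (u + a *\<^sub>R x + b *\<^sub>R y)) x)"
  have "\<exists>b>0. b < r \<and> \<psi> r - \<psi> 0 = (r - 0) *
      frechet_derivative (\<lambda>p. frechet_derivative h (at p) x) (at (u + a *\<^sub>R x + b *\<^sub>R y)) y"
    unfolding \<psi>_def
  proof (rule MVT2[OF r])
    fix b assume "0 \<le> b" "b \<le> r"
    then show "((\<lambda>b. frechet_derivative h (at (u + a *\<^sub>R x + b *\<^sub>R y)) x) has_real_derivative
       frechet_derivative (\<lambda>p. frechet_derivative h (at p) x) (at (u + a *\<^sub>R x + b *\<^sub>R y)) y) (at b)"
      using S a by (intro deriv_line[where k = "\<lambda>p. frechet_derivative h (at p) x"] hx) auto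
  qed
  then obtain b where b: "0 < b" "b < r" and eq2: "\<psi> r - \<psi> 0 = r *
      frechet_derivative (\<lambda>p. frechet_derivative h (at p) x) (at (u + a *\<^sub>R x + b *\<^sub>R y)) y"
    by auto
  have e: "u + r *\<^sub>R y + a *\<^sub>R x = u + a *\<^sub>R x + r *\<^sub>R y" "u + r *\<^sub>R y + r *\<^sub>R x = u + r *\<^sub>R x + r *\<^sub>R y"
    by (simp_all add: algebra_simps)
  have "h (u + r *\<^sub>R x + r *\<^sub>R y) - h (u + r *\<^sub>R x) - h (u + r *\<^sub>R y) + h u = \<phi> r - \<phi> 0"
    by (simp add: \<phi>_def e)
  also have "\<dots> = r * (\<psi> r - \<psi> 0)"
    by (simp add: eq1 e \<psi>_def)
  finally show ?thesis
    using that[OF a b] by (simp add: eq2 power2_eq_square)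
qed

lemma frechet_derivative_commute_real:
  fixes h :: "'a::euclidean_space \<Rightarrow> real"
  assumes "open S" "smooth_on S h" "u \<in> S"
  shows "frechet_derivative (\<lambda>p. frechet_derivative h (at p) x) (at u) y =
    frechet_derivative (\<lambda>p. frechet_derivative h (at p) y) (at u) x"
proof -
  let ?D = "\<lambda>x y p. frechet_derivative (\<lambda>p. frechet_derivative h (at p) x) (at p) y"
  have cont: "\<exists>d>0. \<forall>p. dist p u < d \<longrightarrow> p \<in> S \<and> dist (?D x y p) (?D x y u) < e" if "e > 0" for x y e
  proof -
    have "smooth_on S (?D x y)"
      by (intro smooth_on_frechet_derivative assms)
    then have "continuous (at u) (?D x y)"
      using assms(3) smooth_onD differentiable_imp_continuous_within by blast
    then obtain d1 where "d1 > 0" "\<forall>p. dist p u < d1 \<longrightarrow> dist (?D x y p) (?D x y u) < e"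
      using \<open>e > 0\<close> unfolding continuous_at_eps_delta by blast
    moreover obtain d2 where "d2 > 0" "\<forall>p. dist p u < d2 \<longrightarrow> p \<in> S"
      using assms(1,3) by (metis open_dist)
    ultimately show ?thesis
      by (intro exI[of _ "min d1 d2"]) auto
  qed
  have "dist (?D x y u) (?D y x u) < 2 * e" if "e > 0" for e
  proof -
    obtain d1 where d1: "d1 > 0" "\<And>p. dist p u < d1 \<Longrightarrow> p \<in> S \<and> dist (?D x y p) (?D x y u) < e"
      using cont[OF \<open>e > 0\<close>] by metis
    obtain d2 where d2: "d2 > 0" "\<And>p. dist p u < d2 \<Longrightarrow> p \<in> S \<and> dist (?D y x p) (?D y x u) < e"
      using cont[OF \<open>e > 0\<close>] by metis
    \<comment> \<open>small enough for the whole parallelogram to lie within \<open>min d1 d2\<close> of \<open>u\<close>\<close>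
    define r where "r = min d1 d2 / (norm x + norm y + 1)"
    have pos: "0 < norm x + norm y + 1"
      by (smt (verit) norm_ge_zero)
    have r: "0 < r"
      using d1(1) d2(1) pos by (simp add: r_def)
    have near: "dist (u + a *\<^sub>R x + b *\<^sub>R y) u < min d1 d2" if "0 \<le> a" "a \<le> r" "0 \<le> b" "b \<le> r" for a b
    proof -
      have "dist (u + a *\<^sub>R x + b *\<^sub>R y) u \<le> a * norm x + b * norm y"
        using that norm_triangle_ineq[of "a *\<^sub>R x" "b *\<^sub>R y"] by (simp add: dist_norm add.assoc)
      also have "\<dots> \<le> r * norm x + r * norm y"
        using that by (intro add_mono mult_right_mono) auto
      also have "\<dots> < r * (norm x + norm y + 1)"
        using r by (simp add: algebra_simps)
      also have "\<dots> = min d1 d2"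
        using pos by (simp add: r_def)
      finally show ?thesis .
    qed
    have near': "dist (u + a *\<^sub>R y + b *\<^sub>R x) u < min d1 d2" if "0 \<le> a" "a \<le> r" "0 \<le> b" "b \<le> r" for a b
      using near[OF that(3,4,1,2)] by (simp add: algebra_simps)
    have in_S: "u + a *\<^sub>R x + b *\<^sub>R y \<in> S" "u + a *\<^sub>R y + b *\<^sub>R x \<in> S"
      if "0 \<le> a" "a \<le> r" "0 \<le> b" "b \<le> r" for a b
      using near[OF that] near'[OF that] d1(2) by auto
    note diff = smooth_onD[OF assms(2)] smooth_onD[OF smooth_on_frechet_derivative[OF assms(2)]]
    obtain a b where ab: "0 < a" "a < r" "0 < b" "b < r"
      "h (u + r *\<^sub>R x + r *\<^sub>R y) - h (u + r *\<^sub>R x) - h (u + r *\<^sub>R y) + h u = r\<^sup>2 * ?D x y (u + a *\<^sub>R x + b *\<^sub>R y)"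
      by (rule second_difference_mvt[OF r in_S(1) diff]) auto
    obtain a' b' where ab': "0 < a'" "a' < r" "0 < b'" "b' < r"
      "h (u + r *\<^sub>R y + r *\<^sub>R x) - h (u + r *\<^sub>R y) - h (u + r *\<^sub>R x) + h u = r\<^sup>2 * ?D y x (u + a' *\<^sub>R y + b' *\<^sub>R x)"
      by (rule second_difference_mvt[OF r in_S(2) diff]) auto
    have "u + r *\<^sub>R y + r *\<^sub>R x = u + r *\<^sub>R x + r *\<^sub>R y"
      by simp
    then have "r\<^sup>2 * ?D x y (u + a *\<^sub>R x + b *\<^sub>R y) = r\<^sup>2 * ?D y x (u + a' *\<^sub>R y + b' *\<^sub>R x)"
      using ab(5) ab'(5) by (simp only:)
    then have "?D x y (u + a *\<^sub>R x + b *\<^sub>R y) = ?D y x (u + a' *\<^sub>R y + b' *\<^sub>R x)"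
      using r by simp
    moreover have "dist (?D x y (u + a *\<^sub>R x + b *\<^sub>R y)) (?D x y u) < e"
      using d1(2) near[of a b] ab by simp
    moreover have "dist (?D y x (u + a' *\<^sub>R y + b' *\<^sub>R x)) (?D y x u) < e"
      using d2(2) near'[of a' b'] ab' by simp
    ultimately show ?thesis
      by (smt (verit) dist_commute dist_triangle)
  qed
  from this[of "dist (?D x y u) (?D y x u) / 2"] show ?thesis
    by auto
qed

lemma frechet_derivative_commute:
  fixes h :: "'a::euclidean_space \<Rightarrow> 'b::euclidean_space"
  assumes "open S" "smooth_on S h" "u \<in> S"
  shows "frechet_derivative (\<lambda>p. frechet_derivative h (at p) x) (at u) y =
    frechet_derivative (\<lambda>p. frechet_derivative h (at p) y) (at u) x"
proof (rule euclidean_eqI)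
  fix b :: 'b assume "b \<in> Basis"
  have comp: "frechet_derivative (\<lambda>p. g p \<bullet> b) (at p) v = frechet_derivative g (at p) v \<bullet> b"
    if "smooth_on S g" "p \<in> S" for g :: "'a \<Rightarrow> 'b" and p v
    using dir_deriv_bilinear[OF bounded_bilinear_inner smooth_onD[OF that] differentiable_const,
        where X = "\<lambda>_. v"]
    by (simp add: dir_deriv_def)
  have comp2: "frechet_derivative (\<lambda>p. frechet_derivative (\<lambda>p. h p \<bullet> b) (at p) x) (at u) y
     = frechet_derivative (\<lambda>p. frechet_derivative h (at p) x) (at u) y \<bullet> b" for x y
  proof -
    have "dir_deriv (\<lambda>_. y) (\<lambda>p. frechet_derivative h (at p) x \<bullet> b) u
        = dir_deriv (\<lambda>_. y) (\<lambda>p. frechet_derivative (\<lambda>p. h p \<bullet> b) (at p) x) u"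
      by (rule dir_deriv_cong[OF assms(1,3)])
        (use assms comp[OF assms(2)] in
          \<open>auto intro!: smooth_onD[where S = S] smooth_on_inner smooth_on_frechet_derivative\<close>)
    then show ?thesis
      using comp[OF smooth_on_frechet_derivative[OF assms(2)] assms(3)] by (simp add: dir_deriv_def)
  qed
  show "frechet_derivative (\<lambda>p. frechet_derivative h (at p) x) (at u) y \<bullet> b =
    frechet_derivative (\<lambda>p. frechet_derivative h (at p) y) (at u) x \<bullet> b"
    using frechet_derivative_commute_real[OF assms(1) smooth_on_inner[OF assms(1,2) smooth_on_const] assms(3)]
    by (simp flip: comp2)
qed

section \<open>Solutions of linear systems with smooth coefficients\<close>

text \<open>No derivative of \<open>\<phi>\<close> is involved, because the term of the product rule that would contain it is
  multiplied by \<open>G u = 0\<close>. This lets the solution of a linear system be differentiated when it is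
  only known to be continuous.\<close>

lemma has_derivative_continuous_times_vanishing:
  fixes \<phi> :: "'a::euclidean_space \<Rightarrow> real" and G :: "'a \<Rightarrow> 'b::euclidean_space"
  assumes \<phi>: "isCont \<phi> u" and G: "(G has_derivative G') (at u)" and "G u = 0"
  shows "((\<lambda>x. \<phi> x *\<^sub>R G x) has_derivative (\<lambda>v. \<phi> u *\<^sub>R G' v)) (at u)"
proof -
  have lim: "((\<lambda>h. norm (G (u + h) - G u - G' h) / norm h) \<longlongrightarrow> 0) (at 0)" and bl: "bounded_linear G'"
    using G by (auto simp: has_derivative_at)
  obtain K where K: "\<And>h. norm (G' h) \<le> norm h * K" "0 \<le> K"
    using bounded_linear.nonneg_bounded[OF bl] by blast
  have \<phi>0: "((\<lambda>h. \<phi> (u + h)) \<longlongrightarrow> \<phi> u) (at 0)"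
    using \<phi> by (simp add: isCont_iff)
  have "((\<lambda>h. \<bar>\<phi> (u + h)\<bar> * (norm (G (u + h) - G u - G' h) / norm h) + \<bar>\<phi> (u + h) - \<phi> u\<bar> * K)
      \<longlongrightarrow> \<bar>\<phi> u\<bar> * 0 + \<bar>\<phi> u - \<phi> u\<bar> * K) (at 0)"
    by (intro tendsto_intros lim \<phi>0)
  then have lim0: "((\<lambda>h. \<bar>\<phi> (u + h)\<bar> * (norm (G (u + h) - G u - G' h) / norm h) + \<bar>\<phi> (u + h) - \<phi> u\<bar> * K)
      \<longlongrightarrow> 0) (at 0)"
    by simp
  have "norm (\<phi> (u + h) *\<^sub>R G (u + h) - \<phi> u *\<^sub>R G u - \<phi> u *\<^sub>R G' h) / norm h
      \<le> \<bar>\<phi> (u + h)\<bar> * (norm (G (u + h) - G u - G' h) / norm h) + \<bar>\<phi> (u + h) - \<phi> u\<bar> * K"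
    if "h \<noteq> 0" for h
  proof -
    have "\<phi> (u + h) *\<^sub>R G (u + h) - \<phi> u *\<^sub>R G u - \<phi> u *\<^sub>R G' h
        = \<phi> (u + h) *\<^sub>R (G (u + h) - G u - G' h) + (\<phi> (u + h) - \<phi> u) *\<^sub>R G' h"
      by (simp add: assms(3) algebra_simps)
    also have "norm \<dots> \<le> \<bar>\<phi> (u + h)\<bar> * norm (G (u + h) - G u - G' h) + \<bar>\<phi> (u + h) - \<phi> u\<bar> * norm (G' h)"
      by (rule norm_triangle_le) simp
    also have "\<dots> \<le> \<bar>\<phi> (u + h)\<bar> * norm (G (u + h) - G u - G' h) + \<bar>\<phi> (u + h) - \<phi> u\<bar> * (norm h * K)"
      using K by (intro add_left_mono mult_left_mono) auto
    finally show ?thesis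
      using that by (simp add: field_simps)
  qed
  then have ev: "\<forall>\<^sub>F h in at 0. norm (norm (\<phi> (u + h) *\<^sub>R G (u + h) - \<phi> u *\<^sub>R G u - \<phi> u *\<^sub>R G' h) / norm h)
      \<le> \<bar>\<phi> (u + h)\<bar> * (norm (G (u + h) - G u - G' h) / norm h) + \<bar>\<phi> (u + h) - \<phi> u\<bar> * K"
    by (auto simp: eventually_at_filter)
  show ?thesis
    unfolding has_derivative_at
    using Lim_null_comparison[OF ev lim0] bounded_linear_compose[OF bounded_linear_scaleR_right bl]
    by auto
qed

text \<open>Perturbing an invertible system: with \<open>K\<close> a left inverse of \<open>L u\<close>, the solution satisfies the
  fixed point equation \<open>t x = K (b x) - E x (t x)\<close>, where \<open>E x = K \<circ> L x - id\<close> vanishes at \<open>u\<close>.\<close>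

lemma linear_solution_fixed_point:
  fixes L :: "'a::euclidean_space \<Rightarrow> 'e::euclidean_space \<Rightarrow> 'e"
  assumes "open S" and u: "u \<in> S"
    and L: "\<And>x. x \<in> S \<Longrightarrow> linear (L x)" "\<And>x. x \<in> S \<Longrightarrow> inj (L x)"
    and eq: "\<And>x. x \<in> S \<Longrightarrow> L x (t x) = b x"
  shows "\<exists>K. bounded_linear K \<and> (\<forall>z. K (L u z) = z) \<and>
    (\<forall>x\<in>S. t x = K (b x) - (\<Sum>c\<in>Basis. (t x \<bullet> c) *\<^sub>R (K (L x c) - c)))"
proof -
  obtain K where K: "linear K" "K \<circ> L u = id"
    using linear_injective_left_inverse[OF L[OF u]] by blast
  have "(\<Sum>c\<in>Basis. (t x \<bullet> c) *\<^sub>R (K (L x c) - c)) = K (b x) - t x" if x: "x \<in> S" for x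
  proof -
    have "linear (\<lambda>z. K (L x z) - z)"
      by (intro linear_compose_sub linear_ident linear_compose[OF L(1)[OF x] K(1), unfolded o_def])
    from linear_eq_sum_Basis[OF this, of "t x"] show ?thesis
      by (simp add: eq[OF x])
  qed
  then have "\<forall>x\<in>S. t x = K (b x) - (\<Sum>c\<in>Basis. (t x \<bullet> c) *\<^sub>R (K (L x c) - c))"
    by (metis diff_diff_eq2 add_diff_cancel_left')
  moreover have "bounded_linear K" "\<forall>z. K (L u z) = z"
    using K by (simp_all add: linear_conv_bounded_linear pointfree_idE)
  ultimately show ?thesis
    by blast
qed

text \<open>Near \<open>u\<close> the operator \<open>E x\<close> of the fixed point equation has norm below \<open>1/2\<close>, so its contribution
  to \<open>t x - t u\<close> can be absorbed into the left-hand side.\<close>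

lemma continuous_linear_solution:
  fixes L :: "'a::euclidean_space \<Rightarrow> 'e::euclidean_space \<Rightarrow> 'e"
  assumes "open S" and u: "u \<in> S"
    and L: "\<And>x. x \<in> S \<Longrightarrow> linear (L x)" "\<And>x. x \<in> S \<Longrightarrow> inj (L x)"
    and eq: "\<And>x. x \<in> S \<Longrightarrow> L x (t x) = b x"
    and cont: "\<And>z. isCont (\<lambda>x. L x z) u" "isCont b u"
  shows "isCont t u"
proof -
  obtain K where K: "bounded_linear K" "\<forall>z. K (L u z) = z"
    and "\<forall>x\<in>S. t x = K (b x) - (\<Sum>c\<in>Basis. (t x \<bullet> c) *\<^sub>R (K (L x c) - c))"
    using linear_solution_fixed_point[of S u L t b, OF assms(1) u L eq] by blast
  then have fp: "t x = K (b x) - (\<Sum>c\<in>Basis. (t x \<bullet> c) *\<^sub>R (K (L x c) - c))" if "x \<in> S" for x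
    using that by blast
  define e where "e x = (\<Sum>c\<in>Basis. norm (K (L x c) - c))" for x
  define r where "r x = norm (K (b x) - (\<Sum>c\<in>Basis. (t u \<bullet> c) *\<^sub>R (K (L x c) - c)) - t u)" for x
  have lim: "((\<lambda>x. L x z) \<longlongrightarrow> L u z) (at u)" "(b \<longlongrightarrow> b u) (at u)" for z
    using cont by (simp_all add: isCont_def)
  have E0: "((\<lambda>x. K (L x c) - c) \<longlongrightarrow> 0) (at u)" for c
    using tendsto_diff[OF bounded_linear.tendsto[OF K(1) lim(1)[of c]] tendsto_const[of c]] K(2) by simp
  have "(e \<longlongrightarrow> (\<Sum>c\<in>(Basis :: 'e set). norm (0::'e))) (at u)"
    unfolding e_def by (intro tendsto_sum tendsto_norm E0)
  then have e0: "(e \<longlongrightarrow> 0) (at u)"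
    by simp
  have Kb: "K (b u) = t u"
    using K(2)[rule_format, of "t u"] by (simp add: eq[OF u])
  have "(r \<longlongrightarrow> norm (K (b u) - (\<Sum>c\<in>Basis. (t u \<bullet> c) *\<^sub>R 0) - t u)) (at u)"
    unfolding r_def
    by (intro tendsto_norm tendsto_diff tendsto_const tendsto_sum tendsto_scaleR E0
        bounded_linear.tendsto[OF K(1)] lim(2))
  then have r0: "(r \<longlongrightarrow> 0) (at u)"
    by (simp add: Kb)
  have "norm (t x - t u) \<le> 2 * r x" if x: "x \<in> S" and ex: "e x < 1 / 2" for x
  proof -
    let ?E = "\<lambda>v. \<Sum>c\<in>Basis. (v \<bullet> c) *\<^sub>R (K (L x c) - c)"
    have "?E (t x - t u) = ?E (t x) - ?E (t u)"
      by (simp add: inner_diff_left scaleR_left_diff_distrib sum_subtractf)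
    moreover have "t x - t u = (K (b x) - ?E (t x)) - t u"
      by (rule arg_cong[OF fp[OF x]])
    moreover have "q = (a - e\<^sub>2 - s) - d" if "d = e\<^sub>1 - e\<^sub>2" "q = a - e\<^sub>1 - s" for a d e\<^sub>1 e\<^sub>2 q s :: 'e
      using that by simp
    ultimately have "t x - t u = (K (b x) - ?E (t u) - t u) - ?E (t x - t u)"
      by blast
    then have "norm (t x - t u) \<le> r x + norm (?E (t x - t u))"
      unfolding r_def using norm_triangle_ineq4[of "K (b x) - ?E (t u) - t u" "?E (t x - t u)"]
      by presburger
    also have "norm (\<Sum>c\<in>Basis. ((t x - t u) \<bullet> c) *\<^sub>R (K (L x c) - c)) \<le> norm (t x - t u) * e x"
      unfolding e_def sum_distrib_left
      by (rule order_trans[OF norm_sum]) (auto intro!: sum_mono mult_right_mono Basis_le_norm)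
    also have "\<dots> \<le> norm (t x - t u) * (1 / 2)"
      using ex by (intro mult_left_mono) auto
    finally show ?thesis by simp
  qed
  moreover have "\<forall>\<^sub>F x in at u. x \<in> S \<and> e x < 1 / 2"
    using order_tendstoD(2)[OF e0, of "1/2"] eventually_at_in_open'[OF assms(1) u]
    by (simp add: eventually_conj_iff)
  ultimately have "\<forall>\<^sub>F x in at u. norm (t x - t u) \<le> 2 * r x"
    by (auto elim!: eventually_mono)
  then have "((\<lambda>x. t x - t u) \<longlongrightarrow> 0) (at u)"
    by (rule Lim_null_comparison) (use tendsto_mult_right_zero[OF r0] in auto)
  then show ?thesis
    by (simp add: isCont_def Lim_null[symmetric])
qed

text \<open>In the fixed point equation the coordinates of \<open>t x\<close> only occur as factors of differentiable
  functions that vanish at \<open>u\<close>, so that continuity of \<open>t\<close> already gives differentiability.\<close>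

lemma differentiable_linear_solution:
  fixes L :: "'a::euclidean_space \<Rightarrow> 'e::euclidean_space \<Rightarrow> 'e"
  assumes "open S" and u: "u \<in> S"
    and L: "\<And>x. x \<in> S \<Longrightarrow> linear (L x)" "\<And>x. x \<in> S \<Longrightarrow> inj (L x)"
    and eq: "\<And>x. x \<in> S \<Longrightarrow> L x (t x) = b x"
    and diff: "\<And>z. (\<lambda>x. L x z) differentiable (at u)" "b differentiable (at u)"
  shows "t differentiable (at u)"
proof -
  have t: "isCont t u"
    by (rule continuous_linear_solution[OF assms(1-5)])
      (use diff differentiable_imp_continuous_within in blast)+
  obtain K where K: "bounded_linear K" "\<forall>z. K (L u z) = z"
    and "\<forall>x\<in>S. t x = K (b x) - (\<Sum>c\<in>Basis. (t x \<bullet> c) *\<^sub>R (K (L x c) - c))"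
    using linear_solution_fixed_point[of S u L t b, OF assms(1) u L eq] by blast
  then have fp: "t x = K (b x) - (\<Sum>c\<in>Basis. (t x \<bullet> c) *\<^sub>R (K (L x c) - c))" if "x \<in> S" for x
    using that by blast
  have "(\<lambda>x. (t x \<bullet> c) *\<^sub>R (K (L x c) - c)) differentiable (at u)" for c
  proof -
    have "(\<lambda>x. K (L x c) - c) differentiable (at u)"
      using diff(1)[of c] bounded_linear.has_derivative[OF K(1)]
      by (intro differentiable_diff) (auto simp: differentiable_def)
    moreover have "isCont (\<lambda>x. t x \<bullet> c) u"
      using t by (intro continuous_intros)
    ultimately show ?thesis
      using has_derivative_continuous_times_vanishing[of u "\<lambda>x. t x \<bullet> c" "\<lambda>x. K (L x c) - c"]
      by (auto simp: differentiable_def K(2))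
  qed
  moreover have "(\<lambda>x. K (b x)) differentiable (at u)"
    using diff(2) bounded_linear.has_derivative[OF K(1)] by (auto simp: differentiable_def)
  ultimately have "(\<lambda>x. K (b x) - (\<Sum>c\<in>Basis. (t x \<bullet> c) *\<^sub>R (K (L x c) - c))) differentiable (at u)"
    by (intro differentiable_diff differentiable_sum) auto
  then obtain D where D: "((\<lambda>x. K (b x) - (\<Sum>c\<in>Basis. (t x \<bullet> c) *\<^sub>R (K (L x c) - c))) has_derivative D) (at u)"
    unfolding differentiable_def by blast
  have "(t has_derivative D) (at u)"
    by (rule has_derivative_transform_within_open[OF D assms(1) u]) (rule fp[symmetric])
  then show ?thesis
    unfolding differentiable_def by blast
qed

text \<open>By induction on \<open>k\<close>: a directional derivative of the solution solves a system with the
  same matrix, whose right-hand side involves the solution itself but no derivative of it.\<close>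

lemma Ck_on_linear_solution:
  fixes L :: "'a::euclidean_space \<Rightarrow> 'e::euclidean_space \<Rightarrow> 'e"
  assumes S: "open S"
    and L: "\<And>x. x \<in> S \<Longrightarrow> linear (L x)" "\<And>x. x \<in> S \<Longrightarrow> inj (L x)"
    and sL: "\<And>z. smooth_on S (\<lambda>x. L x z)"
    and "Ck_on k b S" and "\<And>x. x \<in> S \<Longrightarrow> L x (t x) = b x"
  shows "Ck_on k t S"
  using assms(5,6)
proof (induction k arbitrary: b t)
  case 0
  have "isCont b x" if "x \<in> S" for x
    using 0(1) S that by (simp add: continuous_on_eq_continuous_at)
  moreover have "isCont (\<lambda>x. L x z) x" if "x \<in> S" for x z
    using smooth_onD[OF sL that] differentiable_imp_continuous_within by blast
  ultimately show ?case
    using continuous_linear_solution[OF S _ L 0(2)] S by (simp add: continuous_on_eq_continuous_at)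
next
  case (Suc k)
  have diff: "t differentiable (at x)" if "x \<in> S" for x
    using differentiable_linear_solution[OF S that L Suc.prems(2)] smooth_onD[OF sL that] Suc.prems(1) that
    by auto
  have "Ck_on k (\<lambda>x. frechet_derivative t (at x) v) S" for v
  proof (rule Suc.IH)
    let ?b' = "\<lambda>x. frechet_derivative b (at x) v
        + (\<Sum>c\<in>Basis. (t x \<bullet> c) *\<^sub>R (-1) *\<^sub>R frechet_derivative (\<lambda>x. L x c) (at x) v)"
    have t: "Ck_on k t S"
      by (rule Suc.IH[OF Ck_on_Suc_imp[OF Suc.prems(1)] Suc.prems(2)])
    have sum: "Ck_on k (\<lambda>x. \<Sum>i\<in>I. h i x) S" if "\<And>i. i \<in> I \<Longrightarrow> Ck_on k (h i) S"
      for I and h :: "'e \<Rightarrow> 'a \<Rightarrow> 'e"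
      using that by (induction I rule: infinite_finite_induct) (auto intro: Ck_on_const Ck_on_add[OF S])
    have dL: "Ck_on k (\<lambda>x. frechet_derivative (\<lambda>x. L x c) (at x) v) S" for c
      using smooth_on_frechet_derivative[OF sL] by (simp add: smooth_on_def)
    show "Ck_on k ?b' S"
      using Suc.prems(1)
      by (intro Ck_on_add[OF S] sum Ck_on_bilinear[OF bounded_bilinear_scaleR S]
          Ck_on_bilinear[OF bounded_bilinear_inner S] t dL Ck_on_const) auto
    show "L x (frechet_derivative t (at x) v) = ?b' x" if x: "x \<in> S" for x
    proof -
      let ?V = "\<lambda>_. v"
      have eq: "b y = (\<Sum>c\<in>Basis. (t y \<bullet> c) *\<^sub>R L y c)" if "y \<in> S" for y
        using linear_eq_sum_Basis[OF L(1)[OF that], of "t y"] Suc.prems(2)[OF that] by simp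
      have dc: "(\<lambda>y. t y \<bullet> c) differentiable (at x)" for c
        using diff[OF x] by (intro differentiable_inner) auto
      have dt: "dir_deriv ?V (\<lambda>y. t y \<bullet> c) x = dir_deriv ?V t x \<bullet> c" for c
        using dir_deriv_bilinear[OF bounded_bilinear_inner diff[OF x] differentiable_const] by simp
      \<comment> \<open>the product rule for \<open>b = L t\<close>, with \<open>t\<close> written in coordinates\<close>
      have "dir_deriv ?V b x = dir_deriv ?V (\<lambda>y. \<Sum>c\<in>Basis. (t y \<bullet> c) *\<^sub>R L y c) x"
        using dir_deriv_cong[OF S x _ eq] Suc.prems(1) x by auto
      also have "\<dots> = (\<Sum>c\<in>Basis. dir_deriv ?V (\<lambda>y. (t y \<bullet> c) *\<^sub>R L y c) x)"
        using dc smooth_onD[OF sL x] by (intro dir_deriv_sum differentiable_scaleR)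
      also have "\<dots> = (\<Sum>c\<in>Basis. (t x \<bullet> c) *\<^sub>R dir_deriv ?V (\<lambda>y. L y c) x) + L x (dir_deriv ?V t x)"
        using linear_eq_sum_Basis[OF L(1)[OF x], of "dir_deriv ?V t x"]
        by (simp add: dir_deriv_bilinear[OF bounded_bilinear_scaleR dc smooth_onD[OF sL x]]
            sum.distrib dt)
      finally show ?thesis
        by (simp add: dir_deriv_def sum_negf)
    qed
  qed
  then show ?case
    using diff by simp
qed

lemma smooth_on_linear_solution:
  fixes L :: "'a::euclidean_space \<Rightarrow> 'e::euclidean_space \<Rightarrow> 'e"
  assumes "open S" "\<And>x. x \<in> S \<Longrightarrow> linear (L x)" "\<And>x. x \<in> S \<Longrightarrow> inj (L x)"
    "\<And>z. smooth_on S (\<lambda>x. L x z)" "smooth_on S b" "\<And>x. x \<in> S \<Longrightarrow> L x (t x) = b x"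
  shows "smooth_on S t"
  unfolding smooth_on_def using Ck_on_linear_solution[OF assms(1-4) _ assms(6)] assms(5)
  by (simp add: smooth_on_def)

section \<open>The Lorentz product\<close>

lemma lorentz_commute: "lorentz v w = lorentz w v"
  by (simp add: lorentz_def inner_commute mult.commute)

lemma bounded_bilinear_lorentz: "bounded_bilinear lorentz"
  unfolding bilinear_conv_bounded_bilinear[symmetric] bilinear_def lorentz_def
  by (auto intro!: linearI simp: algebra_simps)

interpretation lorentz: bounded_bilinear lorentz
  by (rule bounded_bilinear_lorentz)

section \<open>Traces with respect to an orthonormal basis\<close>

lemma orthonormal_independent:
  fixes B :: "'e::euclidean_space set" and g :: "'e \<Rightarrow> 'e \<Rightarrow> real"
  assumes g: "bilinear g" and orth: "\<And>b c. b \<in> B \<Longrightarrow> c \<in> B \<Longrightarrow> g b c = (if b = c then 1 else 0)"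
  shows "independent B"
  unfolding independent_explicit_module
proof (intro allI impI)
  fix t u v assume t: "finite t" "t \<subseteq> B" "(\<Sum>v\<in>t. u v *\<^sub>R v) = 0" "v \<in> t"
  have "0 = g (\<Sum>w\<in>t. u w *\<^sub>R w) v"
    by (simp add: t(3) bilinear_lzero[OF g])
  also have "\<dots> = (\<Sum>w\<in>t. u w * g w v)"
    using g by (simp add: bilinear_def linear_sum[of "\<lambda>x. g x v"] linear_cmul[of "\<lambda>x. g x v"])
  also have "\<dots> = (\<Sum>w\<in>t. if w = v then u w else 0)"
    using t by (intro sum.cong) (auto simp: orth subset_iff)
  finally show "u v = 0"
    using t by simp
qed

text \<open>A \<open>g\<close>-orthonormal set of largest cardinality spans, by a Gram--Schmidt step.\<close>

lemma exists_orthonormal_basis: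
  fixes g :: "'e::euclidean_space \<Rightarrow> 'e \<Rightarrow> real"
  assumes g: "bilinear g" and sym: "\<And>v w. g v w = g w v" and pos: "\<And>v. v \<noteq> 0 \<Longrightarrow> g v v > 0"
  shows "\<exists>B. finite B \<and> span B = UNIV \<and> (\<forall>b\<in>B. \<forall>c\<in>B. g b c = (if b = c then 1 else 0))"
proof -
  let ?P = "\<lambda>B. finite B \<and> (\<forall>b\<in>B. \<forall>c\<in>B. g b c = (if b = c then 1 else 0))"
  have bound: "card B \<le> DIM('e)" if "?P B" for B
    using independent_bound[OF orthonormal_independent[OF g, of B]] that by blast
  have "\<exists>B. ?P B \<and> (\<forall>C. ?P C \<longrightarrow> card C \<le> card B)"
    by (rule ex_has_greatest_nat[where k = "{}" and b = "Suc DIM('e)"])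
      (use bound in \<open>auto simp: less_Suc_eq_le\<close>)
  then obtain B where B: "?P B" "\<And>C. ?P C \<Longrightarrow> card C \<le> card B"
    by blast
  have "v \<in> span B" for v
  proof (rule ccontr)
    assume v: "v \<notin> span B"
    define w where "w = v - (\<Sum>b\<in>B. g v b *\<^sub>R b)"
    have "(\<Sum>b\<in>B. g v b *\<^sub>R b) \<in> span B"
      by (intro span_sum span_scale span_base)
    then have "w \<noteq> 0"
      using v unfolding w_def by (metis eq_iff_diff_eq_0)
    have wb: "g w b = 0" if "b \<in> B" for b
    proof -
      have "g w b = g v b - (\<Sum>c\<in>B. g v c * g c b)"
        using g unfolding w_def by (simp add: bilinear_def linear_diff[of "\<lambda>x. g x b"]
            linear_sum[of "\<lambda>x. g x b"] linear_cmul[of "\<lambda>x. g x b"])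
      also have "(\<Sum>c\<in>B. g v c * g c b) = (\<Sum>c\<in>B. if c = b then g v c else 0)"
        using B(1) that by (intro sum.cong) auto
      finally show ?thesis
        using B(1) that by simp
    qed
    define e where "e = (1 / sqrt (g w w)) *\<^sub>R w"
    have ee: "g e e = 1"
      using pos[OF \<open>w \<noteq> 0\<close>] by (simp add: e_def bilinear_lmul[OF g] bilinear_rmul[OF g])
    have eb: "g e b = 0" "g b e = 0" if "b \<in> B" for b
      using wb[OF that] sym[of b e] by (simp_all add: e_def bilinear_lmul[OF g])
    have "e \<notin> B"
      using ee eb by fastforce
    moreover have "?P (insert e B)"
      using B(1) ee eb by fastforce
    ultimately show False
      using B(2)[of "insert e B"] B(1) by simp
  qed
  then show ?thesis
    using B(1) by blast
qed

lemma orthonormal_expansion: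
  fixes g :: "'e::euclidean_space \<Rightarrow> 'e \<Rightarrow> real" and l :: "'e \<Rightarrow> real"
  assumes g: "bilinear g" and B: "finite B" "span B = UNIV"
    "\<And>b c. b \<in> B \<Longrightarrow> c \<in> B \<Longrightarrow> g b c = (if b = c then 1 else 0)" and l: "linear l"
  shows "l v = (\<Sum>b\<in>B. g v b * l b)"
proof -
  have "linear (\<lambda>v. \<Sum>b\<in>B. g v b * l b)"
    using g by (intro linear_compose_sum ballI linearI)
      (auto simp: bilinear_ladd bilinear_lmul algebra_simps)
  moreover have "l c = (\<Sum>b\<in>B. g c b * l b)" if "c \<in> B" for c
  proof -
    have "(\<Sum>b\<in>B. g c b * l b) = (\<Sum>b\<in>B. if b = c then l b else 0)"
      using that B(3) by (intro sum.cong) auto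
    then show ?thesis
      using that B(1) by simp
  qed
  ultimately show ?thesis
    using linear_eq_on_span[OF l, of _ B v] B(2) by blast
qed

text \<open>The last hypothesis is the semi-parallel condition
  \<open>h (R x y z) w + h z (R x y w) = 0\<close> after the curvature has been replaced by means of the Gauss
  equation for a normal direction of square length \<open>q\<close>; \<open>hsq\<close> is the square of the shape operator,
  as a bilinear form. Contracting \<open>y\<close> with \<open>z\<close> kills everything that contains the trace of \<open>h\<close>, the
  two cubic terms cancel, and \<open>(\<kappa> n - q |h|\<^sup>2) h = 0\<close> remains, with \<open>n = card B\<close>. For a timelike
  normal direction \<open>q\<close> is negative and the factor is positive; for a spacelike one the factor could
  vanish.\<close>

lemma traceless_semi_symmetric_form_zero:
  fixes g h hsq :: "'e \<Rightarrow> 'e \<Rightarrow> real"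
  assumes "finite B" "B \<noteq> {}"
    and sym: "\<And>v w. g v w = g w v" "\<And>v w. h v w = h w v"
    and expand: "\<And>v w. h v w = (\<Sum>b\<in>B. g v b * h b w)"
    and unit: "\<And>b. b \<in> B \<Longrightarrow> g b b = 1"
    and hsq: "\<And>v w. hsq v w = (\<Sum>b\<in>B. h v b * h b w)"
    and trace: "(\<Sum>b\<in>B. h b b) = 0"
    and "0 < \<kappa>" "q \<le> 0"
    and eq: "\<And>x y z w. \<kappa> * (g y z * h x w - g x z * h y w + g y w * h x z - g x w * h y z)
      + q * (h y z * hsq x w - h x z * hsq y w + h y w * hsq x z - h x w * hsq y z) = 0"
  shows "h x w = 0"
proof -
  have cubic: "(\<Sum>b\<in>B. h x b * hsq b w) = (\<Sum>b\<in>B. h b w * hsq x b)"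
  proof -
    have "(\<Sum>b\<in>B. h x b * hsq b w) = (\<Sum>b\<in>B. \<Sum>c\<in>B. h x b * h b c * h c w)"
      by (simp add: hsq sum_distrib_left mult.assoc)
    also have "\<dots> = (\<Sum>c\<in>B. \<Sum>b\<in>B. h x b * h b c * h c w)"
      by (rule sum.swap)
    also have "\<dots> = (\<Sum>b\<in>B. h b w * hsq x b)"
      by (simp add: hsq sum_distrib_left mult_ac)
    finally show ?thesis .
  qed
  have norm2: "(\<Sum>b\<in>B. hsq b b) = (\<Sum>b\<in>B. \<Sum>c\<in>B. (h b c)\<^sup>2)"
    by (simp add: hsq power2_eq_square sym)
  have "(\<Sum>b\<in>B. g b w * h x b) = (\<Sum>b\<in>B. g w b * h b x)"
    by (intro sum.cong refl) (simp add: sym)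
  then have e1: "(\<Sum>b\<in>B. g x b * h b w) = h x w" "(\<Sum>b\<in>B. g b w * h x b) = h x w"
    using expand[of x w] expand[of w x] sym(2)[of w x] by simp_all
  \<comment> \<open>the contraction: the hypothesis with \<open>y = z = b\<close>, summed over \<open>b\<close>\<close>
  have "0 = (\<Sum>b\<in>B. \<kappa> * (g b b * h x w - g x b * h b w + g b w * h x b - g x w * h b b)
      + q * (h b b * hsq x w - h x b * hsq b w + h b w * hsq x b - h x w * hsq b b))"
    by (simp add: eq)
  also have "\<dots> = \<kappa> * ((\<Sum>b\<in>B. g b b) * h x w - (\<Sum>b\<in>B. g x b * h b w) + (\<Sum>b\<in>B. g b w * h x b)
        - g x w * (\<Sum>b\<in>B. h b b))
      + q * ((\<Sum>b\<in>B. h b b) * hsq x w - (\<Sum>b\<in>B. h x b * hsq b w) + (\<Sum>b\<in>B. h b w * hsq x b)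
        - h x w * (\<Sum>b\<in>B. hsq b b))"
    by (simp add: sum.distrib sum_subtractf flip: sum_distrib_left sum_distrib_right)
  also have "\<dots> = (\<kappa> * card B - q * (\<Sum>b\<in>B. \<Sum>c\<in>B. (h b c)\<^sup>2)) * h x w"
    by (simp add: unit trace cubic norm2 e1 algebra_simps)
  finally have "(\<kappa> * card B - q * (\<Sum>b\<in>B. \<Sum>c\<in>B. (h b c)\<^sup>2)) * h x w = 0"
    by simp
  moreover have "0 < \<kappa> * card B"
    using assms(1,2) \<open>0 < \<kappa>\<close> by (simp add: card_gt_0_iff)
  moreover have "q * (\<Sum>b\<in>B. \<Sum>c\<in>B. (h b c)\<^sup>2) \<le> 0"
    using \<open>q \<le> 0\<close> by (intro mult_nonpos_nonneg sum_nonneg) auto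
  ultimately show ?thesis
    by simp
qed

section \<open>Tangential and normal components along an immersion\<close>

text \<open>\<open>S\<close> is the image of a chart and \<open>F\<close> the immersion read in it; positivity of the induced metric
  makes \<open>dF u\<close> injective.\<close>

locale spacelike_patch =
  fixes S :: "'e::euclidean_space set" and \<kappa> :: real
    and F :: "'e \<Rightarrow> real \<times> 'b::euclidean_space"
  assumes open_S: "open S" and smooth_F: "smooth_on S F"
    and \<kappa>_pos: "0 < \<kappa>"
    and F_de_sitter: "\<And>u. u \<in> S \<Longrightarrow> lorentz (F u) (F u) = 1 / \<kappa>"
    and metric_pos: "\<And>u v. u \<in> S \<Longrightarrow> v \<noteq> 0 \<Longrightarrow> 0 < induced_metric F u v v"
begin

abbreviation dF :: "'e \<Rightarrow> 'e \<Rightarrow> real \<times> 'b" where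
  "dF u \<equiv> frechet_derivative F (at u)"

lemma linear_dF: "u \<in> S \<Longrightarrow> linear (dF u)"
  using smooth_onD[OF smooth_F] by (rule linear_frechet_derivative)

lemma bilinear_metric: "u \<in> S \<Longrightarrow> bilinear (induced_metric F u)"
  unfolding bilinear_def induced_metric_def
  using linear_dF[of u]
  by (auto intro!: linearI simp: linear_add linear_cmul lorentz.add_left lorentz.add_right
      lorentz.scaleR_left lorentz.scaleR_right)

lemma metric_nondegenerate:
  assumes "u \<in> S" "\<And>z. lorentz (dF u t) (dF u z) = 0"
  shows "t = 0"
  using metric_pos[OF assms(1), of t] assms(2)[of t] by (force simp: induced_metric_def)

text \<open>The operator of the Gram matrix. The tangential component \<open>dF u t\<close> of an ambient vector is found
  by solving a linear system with this operator, which makes it a smooth function of \<open>u\<close>.\<close>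

definition gram :: "'e \<Rightarrow> 'e \<Rightarrow> 'e" where
  "gram u t = (\<Sum>b\<in>Basis. lorentz (dF u t) (dF u b) *\<^sub>R b)"

lemma gram_eq_iff:
  assumes u: "u \<in> S"
  shows "gram u t = (\<Sum>b\<in>Basis. lorentz v (dF u b) *\<^sub>R b) \<longleftrightarrow>
    (\<forall>z. lorentz (dF u t) (dF u z) = lorentz v (dF u z))"
proof
  assume eq: "gram u t = (\<Sum>b\<in>Basis. lorentz v (dF u b) *\<^sub>R b)"
  have "lorentz (dF u t) (dF u b) = lorentz v (dF u b)" if "b \<in> Basis" for b
    using arg_cong[OF eq, of "\<lambda>x. x \<bullet> b"] that by (simp add: gram_def)
  moreover have lin: "linear (\<lambda>z. lorentz w (dF u z))" for w
    using linear_dF[OF u] by (intro linearI) (simp_all add: linear_add linear_cmul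
        lorentz.add_right lorentz.scaleR_right)
  ultimately have "(\<lambda>z. lorentz (dF u t) (dF u z)) = (\<lambda>z. lorentz v (dF u z))"
    by (intro linear_eq_stdbasis)
  then show "\<forall>z. lorentz (dF u t) (dF u z) = lorentz v (dF u z)"
    by (rule fun_cong[THEN allI])
qed (simp add: gram_def)

lemma linear_gram: "u \<in> S \<Longrightarrow> linear (gram u)"
  unfolding gram_def
  by (intro linear_compose_sum ballI linearI)
    (simp_all add: linear_add[OF linear_dF] linear_cmul[OF linear_dF] lorentz.add_left
      lorentz.scaleR_left scaleR_add_left)

lemma inj_gram:
  assumes "u \<in> S"
  shows "inj (gram u)"
proof -
  have "t = 0" if "gram u t = 0" for t
    using gram_eq_iff[OF assms, of t 0] that
    by (intro metric_nondegenerate[OF assms]) (simp add: lorentz.zero_left)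
  then show ?thesis
    using linear_injective_0[OF linear_gram[OF assms]] by blast
qed

definition tangent_coord :: "'e \<Rightarrow> real \<times> 'b \<Rightarrow> 'e" where
  "tangent_coord u v = (THE t. \<forall>z. lorentz (dF u t) (dF u z) = lorentz v (dF u z))"

lemma tangent_coord_unique:
  assumes u: "u \<in> S" and "\<And>z. lorentz (dF u t) (dF u z) = lorentz v (dF u z)"
  shows "tangent_coord u v = t"
  unfolding tangent_coord_def
proof (rule the_equality)
  fix s assume "\<forall>z. lorentz (dF u s) (dF u z) = lorentz v (dF u z)"
  then have "gram u s = gram u t"
    using gram_eq_iff[OF u, of s v] gram_eq_iff[OF u, of t v] assms(2) by simp
  then show "s = t"
    by (rule injD[OF inj_gram[OF u]])
qed (use assms(2) in simp)

lemma lorentz_dF_tangent_coord: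
  assumes u: "u \<in> S"
  shows "lorentz (dF u (tangent_coord u v)) (dF u z) = lorentz v (dF u z)"
proof -
  obtain t where "gram u t = (\<Sum>b\<in>Basis. lorentz v (dF u b) *\<^sub>R b)"
    using linear_injective_imp_surjective[OF linear_gram[OF u] inj_gram[OF u]] by (metis surjD)
  then show ?thesis
    using gram_eq_iff[OF u] tangent_coord_unique[OF u, of t v] by simp
qed

lemma linear_tangent_coord:
  assumes "u \<in> S"
  shows "linear (tangent_coord u)"
  by (intro linearI tangent_coord_unique[OF assms])
    (simp_all add: linear_add[OF linear_dF[OF assms]] linear_cmul[OF linear_dF[OF assms]]
      lorentz.add_left lorentz.scaleR_left lorentz_dF_tangent_coord[OF assms])

lemma tangent_coord_dF: "u \<in> S \<Longrightarrow> tangent_coord u (dF u t) = t"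
  by (rule tangent_coord_unique) simp_all

lemma smooth_dF: "smooth_on S (\<lambda>u. dF u z)"
  by (rule smooth_on_frechet_derivative[OF smooth_F])

lemma smooth_lorentz:
  "smooth_on S V \<Longrightarrow> smooth_on S W \<Longrightarrow> smooth_on S (\<lambda>u. lorentz (V u) (W u))"
  by (rule smooth_on_bilinear[OF bounded_bilinear_lorentz open_S])

lemma smooth_tangent_coord:
  assumes "smooth_on S V"
  shows "smooth_on S (\<lambda>u. tangent_coord u (V u))"
proof (rule smooth_on_linear_solution[OF open_S linear_gram inj_gram])
  show "smooth_on S (\<lambda>u. gram u z)" for z
    unfolding gram_def
    by (intro smooth_on_sum smooth_on_scaleR open_S smooth_lorentz smooth_dF smooth_on_const)
  show "smooth_on S (\<lambda>u. \<Sum>b\<in>Basis. lorentz (V u) (dF u b) *\<^sub>R b)"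
    by (intro smooth_on_sum smooth_on_scaleR open_S smooth_lorentz smooth_dF smooth_on_const assms)
  show "gram u (tangent_coord u (V u)) = (\<Sum>b\<in>Basis. lorentz (V u) (dF u b) *\<^sub>R b)" if "u \<in> S" for u
    using gram_eq_iff[OF that] lorentz_dF_tangent_coord[OF that] by blast
qed

lemma dir_deriv_lorentz:
  assumes "smooth_on S V" "smooth_on S W" "u \<in> S"
  shows "dir_deriv X (\<lambda>u. lorentz (V u) (W u)) u =
    lorentz (V u) (dir_deriv X W u) + lorentz (dir_deriv X V u) (W u)"
  using dir_deriv_bilinear[OF bounded_bilinear_lorentz] smooth_onD assms by blast

text \<open>The flat derivative is compatible with the Lorentz product. All orthogonality relations below are
  differentiated by this rule.\<close>

lemma dir_deriv_lorentz_const: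
  assumes "smooth_on S V" "smooth_on S W" "u \<in> S" "\<And>p. p \<in> S \<Longrightarrow> lorentz (V p) (W p) = c"
  shows "lorentz (dir_deriv X V u) (W u) = - lorentz (V u) (dir_deriv X W u)"
proof -
  have "dir_deriv X (\<lambda>u. lorentz (V u) (W u)) u = dir_deriv X (\<lambda>_. c) u"
    by (rule dir_deriv_cong[OF open_S assms(3) smooth_onD[OF smooth_lorentz[OF assms(1,2)] assms(3)] assms(4)])
  then show ?thesis
    by (simp add: dir_deriv_lorentz[OF assms(1-3)])
qed

lemma lorentz_dF_F: "u \<in> S \<Longrightarrow> lorentz (dF u z) (F u) = 0"
  using dir_deriv_lorentz_const[OF smooth_F smooth_F _ F_de_sitter, of u "\<lambda>_. z"]
    lorentz_commute[of "F u" "dF u z"]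
  by (simp add: dir_deriv_def)

text \<open>At each point the ambient space is the orthogonal sum of the line spanned by \<open>F u\<close>, the tangent
  space \<open>range (dF u)\<close> and the normal space. Since \<open>lorentz (F u) (F u) = 1 / \<kappa>\<close>, the middle term is
  the component along the position vector. Working with this projection of arbitrary vectors
  avoids the choice of a local normal field.\<close>

definition normal_comp :: "'e \<Rightarrow> real \<times> 'b \<Rightarrow> real \<times> 'b" where
  "normal_comp u v = v - (\<kappa> * lorentz v (F u)) *\<^sub>R F u - dF u (tangent_coord u v)"

lemma normal_space_lorentz:
  assumes "w \<in> normal_space F u"
  shows "lorentz w (F u) = 0" "lorentz (F u) w = 0" "lorentz w (dF u z) = 0" "lorentz (dF u z) w = 0"
  using assms lorentz_commute[of "F u" w] lorentz_commute[of "dF u z" w] by (auto simp: normal_space_def)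

lemma normal_comp_in_normal_space: "u \<in> S \<Longrightarrow> normal_comp u v \<in> normal_space F u"
  using \<kappa>_pos
  by (simp add: normal_space_def normal_comp_def lorentz.diff_left lorentz.scaleR_left
      F_de_sitter lorentz_dF_F lorentz_dF_tangent_coord lorentz_commute[of "F u" "dF u _"])

lemma linear_normal_comp:
  assumes "u \<in> S"
  shows "linear (normal_comp u)"
  unfolding normal_comp_def
  by (intro linearI)
    (simp_all add: linear_add[OF linear_tangent_coord[OF assms]] linear_cmul[OF linear_tangent_coord[OF assms]]
      linear_add[OF linear_dF[OF assms]] linear_cmul[OF linear_dF[OF assms]]
      lorentz.add_left lorentz.scaleR_left algebra_simps)

lemma normal_comp_dF: "u \<in> S \<Longrightarrow> normal_comp u (dF u z) = 0"
  by (simp add: normal_comp_def lorentz_dF_F tangent_coord_dF)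

lemma lorentz_normal_comp:
  assumes "w \<in> normal_space F u"
  shows "lorentz w (normal_comp u v) = lorentz w v"
  using normal_space_lorentz[OF assms]
  by (simp add: normal_comp_def lorentz.diff_right lorentz.scaleR_right)

lemma smooth_normal_comp:
  assumes "smooth_on S V"
  shows "smooth_on S (\<lambda>u. normal_comp u (V u))"
proof -
  have "smooth_on S (dir_deriv (\<lambda>u. tangent_coord u (V u)) F)"
    by (intro smooth_on_dir_deriv open_S smooth_tangent_coord assms smooth_F)
  then have "smooth_on S (\<lambda>u. V u - (\<kappa> *\<^sub>R lorentz (V u) (F u)) *\<^sub>R F u - dir_deriv (\<lambda>u. tangent_coord u (V u)) F u)"
    by (intro smooth_on_diff smooth_on_scaleR smooth_on_const smooth_lorentz open_S assms smooth_F)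
  then show ?thesis
    by (simp add: normal_comp_def[abs_def] dir_deriv_def)
qed

lemma normal_part_ambient:
  assumes u: "u \<in> S"
  shows "normal_part F u (v - (\<kappa> * lorentz v (F u)) *\<^sub>R F u) = normal_comp u v"
  unfolding normal_part_def
proof (rule the_equality)
  let ?v = "v - (\<kappa> * lorentz v (F u)) *\<^sub>R F u"
  show "normal_comp u v \<in> normal_space F u \<and> ?v - normal_comp u v \<in> range (dF u)"
    using normal_comp_in_normal_space[OF u] by (simp add: normal_comp_def)
  fix w assume w: "w \<in> normal_space F u \<and> ?v - w \<in> range (dF u)"
  then obtain t where t: "?v - w = dF u t"
    by blast
  then have "normal_comp u v - w = dF u (t - tangent_coord u v)"
    by (simp add: normal_comp_def linear_diff[OF linear_dF[OF u]] algebra_simps)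
  moreover have "lorentz (normal_comp u v - w) (dF u z) = 0" for z
    using w normal_comp_in_normal_space[OF u, of v] by (simp add: normal_space_def lorentz.diff_left)
  ultimately have "t - tangent_coord u v = 0"
    using metric_nondegenerate[OF u] by metis
  then show "w = normal_comp u v"
    using t by (simp add: normal_comp_def algebra_simps)
qed

section \<open>Second derivatives of the immersion and the Levi-Civita connection\<close>

text \<open>The second derivative \<open>D\<^sup>2F(x, y)\<close> in the flat ambient space.\<close>

definition hess :: "'e \<Rightarrow> 'e \<Rightarrow> 'e \<Rightarrow> real \<times> 'b" where
  "hess u x y = frechet_derivative (\<lambda>p. dF p y) (at u) x"

definition II :: "'e \<Rightarrow> 'e \<Rightarrow> 'e \<Rightarrow> real \<times> 'b" where
  "II u x y = normal_comp u (hess u x y)"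

lemma smooth_hess: "smooth_on S (\<lambda>u. hess u x y)"
  unfolding hess_def by (intro smooth_on_frechet_derivative smooth_F)

lemma hess_commute: "u \<in> S \<Longrightarrow> hess u x y = hess u y x"
  unfolding hess_def using frechet_derivative_commute[OF open_S smooth_F] .

lemma linear_hess:
  assumes "u \<in> S"
  shows "linear (\<lambda>x. hess u x y)" "linear (hess u x)"
proof -
  show *: "linear (\<lambda>x. hess u x y)" for y
    unfolding hess_def
    using linear_frechet_derivative[OF smooth_onD[OF smooth_dF assms]] .
  show "linear (hess u x)"
    using *[of x] hess_commute[OF assms, of x] by presburger
qed

lemma bilinear_lorentz_II: "u \<in> S \<Longrightarrow> bilinear (\<lambda>x y. lorentz w (II u x y))"
  unfolding bilinear_def II_def
  by (intro conjI allI linearI)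
    (simp_all add: linear_add[OF linear_hess(1)] linear_cmul[OF linear_hess(1)]
     linear_add[OF linear_hess(2)] linear_cmul[OF linear_hess(2)]
     linear_add[OF linear_normal_comp] linear_cmul[OF linear_normal_comp]
     lorentz.add_right lorentz.scaleR_right)

lemma II_commute: "u \<in> S \<Longrightarrow> II u x y = II u y x"
  by (simp add: II_def hess_commute)

lemma II_normal: "u \<in> S \<Longrightarrow> II u x y \<in> normal_space F u"
  by (simp add: II_def normal_comp_in_normal_space)

lemma dir_deriv_dir_deriv_F:
  assumes Y: "smooth_on S Y" and u: "u \<in> S"
  shows "dir_deriv X (dir_deriv Y F) u = hess u (X u) (Y u) + dF u (dir_deriv X Y u)"
proof -
  have YD: "(\<lambda>u. Y u \<bullet> b) differentiable (at u)" for b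
    using smooth_onD[OF smooth_on_inner[OF open_S Y smooth_on_const] u] .
  have dY: "dir_deriv X (\<lambda>u. Y u \<bullet> b) u = dir_deriv X Y u \<bullet> b" for b
    using dir_deriv_bilinear[OF bounded_bilinear_inner smooth_onD[OF Y u] differentiable_const] by simp
  have "dir_deriv X (dir_deriv Y F) u = dir_deriv X (\<lambda>u. \<Sum>b\<in>Basis. (Y u \<bullet> b) *\<^sub>R dF u b) u"
    by (intro dir_deriv_cong[OF open_S u] smooth_onD[OF smooth_on_dir_deriv[OF open_S Y smooth_F] u]
        dir_deriv_eq_sum_Basis smooth_onD[OF smooth_F])
  also have "\<dots> = (\<Sum>b\<in>Basis. dir_deriv X (\<lambda>u. (Y u \<bullet> b) *\<^sub>R dF u b) u)"
    by (intro dir_deriv_sum differentiable_scaleR YD smooth_onD[OF smooth_dF u])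
  also have "\<dots> = (\<Sum>b\<in>Basis. (Y u \<bullet> b) *\<^sub>R hess u (X u) b) + (\<Sum>b\<in>Basis. (dir_deriv X Y u \<bullet> b) *\<^sub>R dF u b)"
    by (simp add: dir_deriv_bilinear[OF bounded_bilinear_scaleR YD smooth_onD[OF smooth_dF u]] dY
        sum.distrib dir_deriv_def[of X "\<lambda>u. dF u _"] hess_def)
  also have "\<dots> = hess u (X u) (Y u) + dF u (dir_deriv X Y u)"
    by (simp flip: linear_eq_sum_Basis[OF linear_hess(2)[OF u]] linear_eq_sum_Basis[OF linear_dF[OF u]])
  finally show ?thesis .
qed

text \<open>By the product rule, the derivative of the field \<open>Y\<close> only contributes a tangent vector. So the
  second fundamental form depends on the values of its arguments alone.\<close>

lemma second_fundamental_form_eq: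
  assumes "smooth_on S Y" "u \<in> S"
  shows "second_fundamental_form \<kappa> F X Y u = II u (X u) (Y u)"
  unfolding second_fundamental_form_def ambient_conn_def normal_part_ambient[OF assms(2)] II_def
  by (simp add: dir_deriv_dir_deriv_F[OF assms] linear_add[OF linear_normal_comp] normal_comp_dF assms(2))

lemma normal_conn_eq: "u \<in> S \<Longrightarrow> normal_conn \<kappa> F X s u = normal_comp u (dir_deriv X s u)"
  by (simp add: normal_conn_def ambient_conn_def normal_part_ambient)

text \<open>The flat derivative is compatible with the product and, by symmetry of second derivatives, free
  of torsion. Expanding the Koszul formula with these two rules, all terms cancel in pairs except
  two copies of the product of the flat derivative with \<open>dF u z\<close>. So the Levi-Civita connection is
  the tangential part of the flat derivative.\<close>

lemma levi_civita_eq: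
  assumes X: "smooth_on S X" and Y: "smooth_on S Y" and u: "u \<in> S"
  shows "levi_civita F X Y u = tangent_coord u (dir_deriv X (dir_deriv Y F) u)"
proof -
  let ?g = "\<lambda>X Y u. induced_metric F u (X u) (Y u)"
  have koszul: "dir_deriv X (?g Y (\<lambda>_. z)) u + dir_deriv Y (?g X (\<lambda>_. z)) u - dir_deriv (\<lambda>_. z) (?g X Y) u
        + ?g (lie_bracket X Y) (\<lambda>_. z) u - ?g (lie_bracket X (\<lambda>_. z)) Y u - ?g (lie_bracket Y (\<lambda>_. z)) X u
      = 2 * lorentz (dir_deriv X (dir_deriv Y F) u) (dF u z)" for z
  proof -
    let ?Z = "\<lambda>_::'e. z"
    have g: "dir_deriv A (?g B C) u = lorentz (dir_deriv B F u) (dir_deriv A (dir_deriv C F) u)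
        + lorentz (dir_deriv A (dir_deriv B F) u) (dir_deriv C F u)"
      if "smooth_on S B" "smooth_on S C" for A B C
      using dir_deriv_lorentz[OF smooth_on_dir_deriv[OF open_S that(1) smooth_F]
          smooth_on_dir_deriv[OF open_S that(2) smooth_F] u, of A]
      by (simp add: induced_metric_def dir_deriv_def[of _ F, abs_def])
    have lie: "dF u (lie_bracket A B u) = dir_deriv A (dir_deriv B F) u - dir_deriv B (dir_deriv A F) u"
      if "smooth_on S A" "smooth_on S B" for A B
      by (simp add: dir_deriv_dir_deriv_F that u lie_bracket_def linear_diff[OF linear_dF[OF u]]
          hess_commute[OF u, of "A u"])
    have gl: "?g (lie_bracket A B) C u = lorentz (dir_deriv A (dir_deriv B F) u) (dir_deriv C F u)
        - lorentz (dir_deriv B (dir_deriv A F) u) (dir_deriv C F u)"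
      if "smooth_on S A" "smooth_on S B" for A B C
      by (simp add: induced_metric_def lie that lorentz.diff_left dir_deriv_def[of C F])
    have "dF u z = dir_deriv ?Z F u"
      by (simp add: dir_deriv_def)
    moreover note g[OF Y smooth_on_const, of X z] g[OF X smooth_on_const, of Y z] g[OF X Y, of ?Z]
      gl[OF X Y, of ?Z] gl[OF X smooth_on_const, of z Y] gl[OF Y smooth_on_const, of z X]
    ultimately show ?thesis
      by (simp add: lorentz_commute)
  qed
  show ?thesis
    unfolding levi_civita_def Let_def koszul
    unfolding tangent_coord_def induced_metric_def by simp
qed

lemma smooth_levi_civita:
  assumes "smooth_on S X" "smooth_on S Y"
  shows "smooth_on S (levi_civita F X Y)"
  by (rule smooth_on_cong[OF open_S levi_civita_eq[OF assms, symmetric]])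
    (assumption, intro smooth_tangent_coord smooth_on_dir_deriv open_S smooth_F assms)

lemma smooth_curvature_levi_civita:
  assumes "smooth_on S X" "smooth_on S Y" "smooth_on S Z"
  shows "smooth_on S (curvature (levi_civita F) X Y Z)"
  unfolding curvature_def[abs_def] lie_bracket_def[abs_def]
  by (intro smooth_on_diff smooth_levi_civita smooth_on_dir_deriv open_S assms)

lemma lie_bracket_const: "lie_bracket (\<lambda>_. x) (\<lambda>_. y) = (\<lambda>_. 0)"
  by (rule ext) (simp add: lie_bracket_def)

lemma levi_civita_zero: "u \<in> S \<Longrightarrow> levi_civita F (\<lambda>_. 0) (\<lambda>_. z) u = 0"
  by (simp add: levi_civita_eq dir_deriv_dir_deriv_F linear_0[OF linear_hess(1)]
      linear_0[OF linear_dF] linear_0[OF linear_tangent_coord])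

lemma metric_levi_civita:
  assumes "smooth_on S X" "smooth_on S Y" "u \<in> S"
  shows "induced_metric F u (levi_civita F X Y u) w = lorentz (dir_deriv X (dir_deriv Y F) u) (dF u w)"
  by (simp add: induced_metric_def levi_civita_eq[OF assms] lorentz_dF_tangent_coord[OF assms(3)])

section \<open>The equations of Gauss, Weingarten and Ricci\<close>

lemma lorentz_hess_F:
  assumes "u \<in> S"
  shows "lorentz (hess u x y) (F u) = - induced_metric F u x y"
  using dir_deriv_lorentz_const[OF smooth_dF smooth_F assms lorentz_dF_F, of "\<lambda>_. x" y]
  by (simp add: dir_deriv_def hess_def induced_metric_def lorentz_commute)

lemma hess_decomposition:
  assumes "u \<in> S"
  shows "hess u y z = dir_deriv (levi_civita F (\<lambda>_. y) (\<lambda>_. z)) F u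
    + (- \<kappa> * induced_metric F u y z) *\<^sub>R F u + II u y z"
  by (simp add: II_def normal_comp_def lorentz_hess_F[OF assms] dir_deriv_def[of _ F]
      levi_civita_eq[OF _ _ assms] dir_deriv_dir_deriv_F[OF _ assms] linear_0[OF linear_dF[OF assms]])

lemma smooth_metric: "smooth_on S (\<lambda>u. induced_metric F u y z)"
  unfolding induced_metric_def by (intro smooth_lorentz smooth_dF)

lemma smooth_II: "smooth_on S (\<lambda>u. II u y z)"
  unfolding II_def by (intro smooth_normal_comp smooth_hess)

text \<open>The tangential part of a third derivative of \<open>F\<close>, found by differentiating the orthogonal
  decomposition of the second derivative. The tangential summand gives the iterated Levi-Civita
  connection, the summand along \<open>F\<close> the term with \<open>\<kappa>\<close>, and the normal summand, by orthogonality to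
  \<open>dF\<close>, the product of second fundamental forms.\<close>

lemma lorentz_dir_deriv_hess:
  assumes u: "u \<in> S"
  shows "lorentz (dir_deriv (\<lambda>_. x) (\<lambda>u. hess u y z) u) (dF u w) =
    induced_metric F u (levi_civita F (\<lambda>_. x) (levi_civita F (\<lambda>_. y) (\<lambda>_. z)) u) w
    - \<kappa> * induced_metric F u y z * induced_metric F u x w - lorentz (II u y z) (II u x w)"
proof -
  let ?X = "\<lambda>_::'e. x"
  define G where "G = levi_civita F (\<lambda>_. y) (\<lambda>_. z)"
  define \<phi> where "\<phi> = (\<lambda>u. - \<kappa> * induced_metric F u y z)"
  have sG: "smooth_on S G"
    unfolding G_def by (intro smooth_levi_civita smooth_on_const)
  have s1: "smooth_on S (dir_deriv G F)"
    by (rule smooth_on_dir_deriv[OF open_S sG smooth_F])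
  have s\<phi>: "smooth_on S \<phi>"
    using smooth_on_scaleR[OF open_S smooth_on_const[of S "- \<kappa>"] smooth_metric] by (simp add: \<phi>_def)
  have s2: "smooth_on S (\<lambda>u. \<phi> u *\<^sub>R F u)"
    by (rule smooth_on_scaleR[OF open_S s\<phi> smooth_F])
  have "dir_deriv ?X (\<lambda>u. hess u y z) u = dir_deriv ?X (\<lambda>u. dir_deriv G F u + \<phi> u *\<^sub>R F u + II u y z) u"
    by (rule dir_deriv_cong[OF open_S u smooth_onD[OF smooth_hess u]])
      (simp add: hess_decomposition G_def \<phi>_def)
  also have "\<dots> = dir_deriv ?X (dir_deriv G F) u + (\<phi> u *\<^sub>R dF u x + dir_deriv ?X \<phi> u *\<^sub>R F u)
      + dir_deriv ?X (\<lambda>u. II u y z) u"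
    by (simp add: dir_deriv_add smooth_onD[OF _ u] smooth_on_add open_S s1 s2 smooth_II
        dir_deriv_bilinear[OF bounded_bilinear_scaleR smooth_onD[OF s\<phi> u] smooth_onD[OF smooth_F u]]
        dir_deriv_def[of ?X F])
  finally have "lorentz (dir_deriv ?X (\<lambda>u. hess u y z) u) (dF u w) =
      lorentz (dir_deriv ?X (dir_deriv G F) u) (dF u w) + \<phi> u * induced_metric F u x w
      + lorentz (dir_deriv ?X (\<lambda>u. II u y z) u) (dF u w)"
    by (simp add: lorentz.add_left lorentz.scaleR_left induced_metric_def lorentz_dF_F[OF u]
        lorentz_commute[of "F u" "dF u w"])
  also have "lorentz (dir_deriv ?X (\<lambda>u. II u y z) u) (dF u w) = - lorentz (II u y z) (II u x w)"
    using dir_deriv_lorentz_const[OF smooth_II smooth_dF u normal_space_lorentz(3)[OF II_normal], of ?X y z w]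
    by (simp add: II_def[of u x w] lorentz_normal_comp[OF II_normal[OF u]] dir_deriv_def[of _ "\<lambda>p. dF p w"]
        hess_def)
  finally show ?thesis
    using metric_levi_civita[OF smooth_on_const sG u, of x w] by (simp add: \<phi>_def G_def)
qed

text \<open>Third derivatives of \<open>F\<close> are symmetric, so antisymmetrizing the preceding formula in \<open>x\<close>
  and \<open>y\<close> makes its left-hand side vanish.\<close>

lemma gauss_equation:
  assumes u: "u \<in> S"
  shows "induced_metric F u (curvature (levi_civita F) (\<lambda>_. x) (\<lambda>_. y) (\<lambda>_. z) u) w =
    \<kappa> * (induced_metric F u y z * induced_metric F u x w - induced_metric F u x z * induced_metric F u y w)
    + lorentz (II u y z) (II u x w) - lorentz (II u x z) (II u y w)"
proof -
  have "dir_deriv (\<lambda>_. x) (\<lambda>u. hess u y z) u = dir_deriv (\<lambda>_. y) (\<lambda>u. hess u x z) u"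
    unfolding dir_deriv_def hess_def by (rule frechet_derivative_commute[OF open_S smooth_dF u])
  then have "lorentz (dir_deriv (\<lambda>_. x) (\<lambda>u. hess u y z) u) (dF u w)
      = lorentz (dir_deriv (\<lambda>_. y) (\<lambda>u. hess u x z) u) (dF u w)"
    by simp
  then show ?thesis
    unfolding lorentz_dir_deriv_hess[OF u] curvature_def lie_bracket_const
    by (simp add: levi_civita_zero[OF u] bilinear_lsub[OF bilinear_metric[OF u]] algebra_simps)
qed

lemma dir_deriv_const_commute:
  assumes "smooth_on S s" "u \<in> S"
  shows "dir_deriv (\<lambda>_. x) (dir_deriv (\<lambda>_. y) s) u = dir_deriv (\<lambda>_. y) (dir_deriv (\<lambda>_. x) s) u"
  unfolding dir_deriv_def[abs_def] by (rule frechet_derivative_commute[OF open_S assms])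

lemma weingarten_equation:
  assumes s: "smooth_on S s" "\<And>p. p \<in> S \<Longrightarrow> s p \<in> normal_space F p" and u: "u \<in> S"
  shows "induced_metric F u (tangent_coord u (dir_deriv (\<lambda>_. y) s u)) z = - lorentz (s u) (II u y z)"
  using dir_deriv_lorentz_const[OF s(1) smooth_dF u normal_space_lorentz(3)[OF s(2)], of "\<lambda>_. y" z]
  by (simp add: induced_metric_def lorentz_dF_tangent_coord[OF u] II_def lorentz_normal_comp[OF s(2)[OF u]]
      dir_deriv_def[of _ "\<lambda>p. dF p z"] hess_def)

text \<open>The normal part of the symmetry of second derivatives of \<open>s\<close>. The vector
  \<open>tangent_coord u (dir_deriv (\<lambda>_. x) s u)\<close> is the negative of the shape operator in direction
  \<open>s u\<close>, applied to \<open>x\<close>. So the right-hand side, paired with a normal vector, becomes a commutator of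
  shape operators.\<close>

lemma ricci_equation:
  assumes s: "smooth_on S s" "\<And>p. p \<in> S \<Longrightarrow> s p \<in> normal_space F p" and u: "u \<in> S"
  shows "curvature (normal_conn \<kappa> F) (\<lambda>_. x) (\<lambda>_. y) s u =
    II u y (tangent_coord u (dir_deriv (\<lambda>_. x) s u)) - II u x (tangent_coord u (dir_deriv (\<lambda>_. y) s u))"
proof -
  have split: "normal_comp u (dir_deriv (\<lambda>_. x) (dir_deriv (\<lambda>_. y) s) u) =
      II u x (tangent_coord u (dir_deriv (\<lambda>_. y) s u))
      + normal_conn \<kappa> F (\<lambda>_. x) (normal_conn \<kappa> F (\<lambda>_. y) s) u" for x y
  proof -
    let ?V = "dir_deriv (\<lambda>_. y) s"
    define T where "T = (\<lambda>p. tangent_coord p (?V p))"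
    define N where "N = (\<lambda>p. normal_comp p (?V p))"
    have sV: "smooth_on S ?V"
      by (intro smooth_on_dir_deriv open_S smooth_on_const s)
    have sT: "smooth_on S T" and sN: "smooth_on S N"
      unfolding T_def N_def by (intro smooth_tangent_coord smooth_normal_comp sV)+
    have sTF: "smooth_on S (dir_deriv T F)"
      by (rule smooth_on_dir_deriv[OF open_S sT smooth_F])
    have "?V p = dir_deriv T F p + N p" if p: "p \<in> S" for p
    proof -
      have "lorentz (?V p) (F p) = 0"
        using dir_deriv_lorentz_const[OF s(1) smooth_F p normal_space_lorentz(1)[OF s(2)], of "\<lambda>_. y"]
          normal_space_lorentz(3)[OF s(2)[OF p]] by (simp add: dir_deriv_def[of _ F])
      then show ?thesis
        by (simp add: T_def N_def normal_comp_def dir_deriv_def[of _ F])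
    qed
    then have "dir_deriv (\<lambda>_. x) ?V u = dir_deriv (\<lambda>_. x) (\<lambda>p. dir_deriv T F p + N p) u"
      by (rule dir_deriv_cong[OF open_S u smooth_onD[OF sV u]])
    also have "\<dots> = dir_deriv (\<lambda>_. x) (dir_deriv T F) u + dir_deriv (\<lambda>_. x) N u"
      by (rule dir_deriv_add[OF smooth_onD[OF sTF u] smooth_onD[OF sN u]])
    also have "dir_deriv (\<lambda>_. x) N u = dir_deriv (\<lambda>_. x) (normal_conn \<kappa> F (\<lambda>_. y) s) u"
      by (rule dir_deriv_cong[OF open_S u smooth_onD[OF sN u]]) (simp add: N_def normal_conn_eq)
    finally have "normal_comp u (dir_deriv (\<lambda>_. x) ?V u) = normal_comp u (dir_deriv (\<lambda>_. x) (dir_deriv T F) u)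
        + normal_conn \<kappa> F (\<lambda>_. x) (normal_conn \<kappa> F (\<lambda>_. y) s) u"
      by (simp add: linear_add[OF linear_normal_comp[OF u]] normal_conn_eq[OF u])
    also have "normal_comp u (dir_deriv (\<lambda>_. x) (dir_deriv T F) u) = II u x (T u)"
      by (simp add: linear_add[OF linear_normal_comp[OF u]] dir_deriv_dir_deriv_F[OF sT u]
          normal_comp_dF[OF u] II_def)
    finally show ?thesis
      by (simp add: T_def)
  qed
  have zero: "normal_conn \<kappa> F (\<lambda>_. 0) s u = 0"
    using linear_0[OF linear_frechet_derivative[OF smooth_onD[OF s(1) u]]]
    by (simp add: normal_conn_eq[OF u] dir_deriv_def linear_0[OF linear_normal_comp[OF u]])
  show ?thesis
    using split[of x y] split[of y x] dir_deriv_const_commute[OF s(1) u, of x y]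
    unfolding curvature_def lie_bracket_const by (simp add: zero algebra_simps)
qed

end

section \<open>Semi-parallel extremal hypersurfaces\<close>

text \<open>De Sitter space has dimension \<open>DIM('b)\<close>; hence this is codimension one.\<close>

locale spacelike_hypersurface_patch = spacelike_patch S \<kappa> F
  for S :: "'e::euclidean_space set" and \<kappa> :: real
    and F :: "'e \<Rightarrow> real \<times> 'b::euclidean_space" +
  assumes codim_1: "DIM('b) = DIM('e) + 1"
begin

text \<open>Any nonzero normal vector completes the position vector and the tangent space to the whole space:
  orthogonality gives linear independence, and the dimensions agree. Both the causal character of
  the normal space and its being a line follow from this.\<close>

lemma frame_surjective:
  assumes u: "u \<in> S" and \<nu>: "\<nu> \<in> normal_space F u" "\<nu> \<noteq> 0"
  shows "\<exists>t a c. v = dF u t + a *\<^sub>R F u + c *\<^sub>R \<nu>"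
proof -
  define \<Phi> where "\<Phi> = (\<lambda>(t, a, c). dF u t + a *\<^sub>R F u + c *\<^sub>R \<nu>)"
  have lin: "linear \<Phi>"
    by (rule linearI) (auto simp: \<Phi>_def linear_add[OF linear_dF[OF u]] linear_cmul[OF linear_dF[OF u]]
        algebra_simps)
  have "t = 0 \<and> a = 0 \<and> c = 0" if eq: "dF u t + a *\<^sub>R F u + c *\<^sub>R \<nu> = 0" for t a c
  proof -
    have l: "lorentz (dF u t + a *\<^sub>R F u + c *\<^sub>R \<nu>) w = 0" for w
      by (simp add: eq lorentz.zero_left)
    have "a = 0"
      using l[of "F u"] \<kappa>_pos
      by (simp add: lorentz.add_left lorentz.scaleR_left lorentz_dF_F[OF u] F_de_sitter[OF u]
          normal_space_lorentz[OF \<nu>(1)])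
    moreover have "t = 0"
      using l[of "dF u _"] \<open>a = 0\<close>
      by (intro metric_nondegenerate[OF u])
        (simp add: lorentz.add_left lorentz.scaleR_left normal_space_lorentz[OF \<nu>(1)])
    ultimately show ?thesis
      using eq \<nu>(2) by (simp add: linear_0[OF linear_dF[OF u]])
  qed
  then have "inj \<Phi>"
    using linear_injective_0[OF lin] by (auto simp: \<Phi>_def zero_prod_def)
  then have "dim (range \<Phi>) = DIM(real \<times> 'b)"
    using dim_image_eq[OF lin, of UNIV] codim_1 by simp
  then have "range \<Phi> = UNIV"
    using linear_subspace_image[OF lin subspace_UNIV] by (metis dim_eq_full span_eq_iff)
  then obtain p where "v = \<Phi> p"
    by (metis surjD)
  then show ?thesis
    by (cases p) (auto simp: \<Phi>_def)
qed

text \<open>Otherwise the Lorentz product would be positive semidefinite, since it is positive on the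
  tangent space and on \<open>F u\<close>; but it is negative on \<open>(1, 0)\<close>.\<close>

lemma normal_timelike:
  assumes u: "u \<in> S" and \<nu>: "\<nu> \<in> normal_space F u" "\<nu> \<noteq> 0"
  shows "lorentz \<nu> \<nu> < 0"
proof (rule ccontr)
  assume "\<not> lorentz \<nu> \<nu> < 0"
  obtain t a c where v: "(1, 0) = dF u t + a *\<^sub>R F u + c *\<^sub>R \<nu>"
    using frame_surjective[OF assms] by blast
  have "lorentz (dF u t + a *\<^sub>R F u + c *\<^sub>R \<nu>) (dF u t + a *\<^sub>R F u + c *\<^sub>R \<nu>)
      = induced_metric F u t t + a\<^sup>2 / \<kappa> + c\<^sup>2 * lorentz \<nu> \<nu>"
    by (simp add: lorentz.add_left lorentz.scaleR_left lorentz.add_right lorentz.scaleR_right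
        lorentz_dF_F[OF u] lorentz_commute[of "F u" "dF u _"] F_de_sitter[OF u]
        normal_space_lorentz[OF \<nu>(1)] induced_metric_def power2_eq_square)
  moreover have "0 \<le> induced_metric F u t t"
    using metric_pos[OF u, of t] bilinear_lzero[OF bilinear_metric[OF u]] by (cases "t = 0") auto
  moreover have "lorentz (1, 0 :: 'b) (1, 0) = - 1"
    by (simp add: lorentz_def)
  moreover have "0 \<le> a\<^sup>2 / \<kappa>" "0 \<le> c\<^sup>2 * lorentz \<nu> \<nu>"
    using \<kappa>_pos \<open>\<not> lorentz \<nu> \<nu> < 0\<close> by auto
  ultimately show False
    using v by simp
qed

text \<open>The normal space is a line on which the product does not vanish.\<close>

lemma normal_space_eqI:
  assumes u: "u \<in> S" and \<nu>: "\<nu> \<in> normal_space F u" "\<nu> \<noteq> 0"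
    and w: "w \<in> normal_space F u" "w' \<in> normal_space F u" "lorentz \<nu> w = lorentz \<nu> w'"
  shows "w = w'"
proof -
  obtain t a c where v: "w - w' = dF u t + a *\<^sub>R F u + c *\<^sub>R \<nu>"
    using frame_surjective[OF u \<nu>] by blast
  have l: "lorentz (w - w') x = lorentz (dF u t + a *\<^sub>R F u + c *\<^sub>R \<nu>) x" for x
    by (simp add: v)
  have "a = 0"
    using l[of "F u"] \<kappa>_pos
    by (simp add: lorentz.add_left lorentz.diff_left lorentz.scaleR_left lorentz_dF_F[OF u] F_de_sitter[OF u]
        normal_space_lorentz[OF \<nu>(1)] normal_space_lorentz[OF w(1)] normal_space_lorentz[OF w(2)])
  moreover have "t = 0"
    using l[of "dF u _"] \<open>a = 0\<close>
    by (intro metric_nondegenerate[OF u])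
      (simp add: lorentz.add_left lorentz.diff_left lorentz.scaleR_left
        normal_space_lorentz[OF \<nu>(1)] normal_space_lorentz[OF w(1)] normal_space_lorentz[OF w(2)])
  moreover have "c = 0"
    using l[of \<nu>] w(3) normal_timelike[OF u \<nu>] \<open>a = 0\<close> \<open>t = 0\<close>
    by (simp add: lorentz.diff_left lorentz.scaleR_left lorentz_commute[of w] lorentz_commute[of w']
        linear_0[OF linear_dF[OF u]])
  ultimately show ?thesis
    using v by (simp add: linear_0[OF linear_dF[OF u]])
qed

text \<open>In codimension one all shape operators at a point are proportional, so they commute. Here
  \<open>s u\<close> itself serves as the generator of the normal line if it is nonzero; if it is zero, its shape
  operator is zero.\<close>

lemma normal_curvature_zero:
  assumes s: "smooth_on S s" "\<And>p. p \<in> S \<Longrightarrow> s p \<in> normal_space F p" and u: "u \<in> S"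
  shows "curvature (normal_conn \<kappa> F) (\<lambda>_. x) (\<lambda>_. y) s u = 0"
proof -
  let ?T = "\<lambda>x. tangent_coord u (dir_deriv (\<lambda>_. x) s u)"
  have T: "induced_metric F u (?T x) z = - lorentz (s u) (II u x z)" for x z
    by (rule weingarten_equation[OF s u])
  have "II u y (?T x) = II u x (?T y)"
  proof (cases "s u = 0")
    case True
    then have "?T x = 0" for x
      using T[of x] by (intro metric_nondegenerate[OF u]) (simp add: induced_metric_def lorentz.zero_left)
    then show ?thesis
      using linear_0[OF linear_hess(2)[OF u]] by (simp add: II_def)
  next
    case False
    have "lorentz (s u) (II u y (?T x)) = lorentz (s u) (II u x (?T y))"
      using T[of y "?T x"] T[of x "?T y"] by (simp add: induced_metric_def lorentz_commute)
    then show ?thesis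
      by (rule normal_space_eqI[OF u s(2)[OF u] False II_normal[OF u] II_normal[OF u]])
  qed
  then show ?thesis
    by (simp add: ricci_equation[OF s u])
qed

lemma curvature_action_const:
  assumes u: "u \<in> S"
  shows "curvature_action \<kappa> F (\<lambda>_. x) (\<lambda>_. y) (\<lambda>_. z) (\<lambda>_. w) u =
    - II u (curvature (levi_civita F) (\<lambda>_. x) (\<lambda>_. y) (\<lambda>_. z) u) w
    - II u z (curvature (levi_civita F) (\<lambda>_. x) (\<lambda>_. y) (\<lambda>_. w) u)"
proof -
  have eq: "second_fundamental_form \<kappa> F (\<lambda>_. z) (\<lambda>_. w) p = II p z w" if "p \<in> S" for p
    using second_fundamental_form_eq[OF smooth_on_const that] .
  have "smooth_on S (second_fundamental_form \<kappa> F (\<lambda>_. z) (\<lambda>_. w))"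
    by (rule smooth_on_cong[OF open_S eq[symmetric] smooth_II])
  moreover have "second_fundamental_form \<kappa> F (\<lambda>_. z) (\<lambda>_. w) p \<in> normal_space F p" if "p \<in> S" for p
    using eq[OF that] II_normal[OF that] by simp
  ultimately show ?thesis
    unfolding curvature_action_def Let_def
    by (simp add: normal_curvature_zero[OF _ _ u] second_fundamental_form_eq[OF _ u]
        smooth_curvature_levi_civita)
qed

text \<open>A nonzero value \<open>\<nu>\<close> of the form would span the normal line, and the whole form would be
  \<open>h \<nu>\<close> with a real-valued \<open>h\<close>. The semi-parallel condition and the Gauss equation then give the
  last hypothesis of \<open>traceless_semi_symmetric_form_zero\<close> for \<open>h\<close>; vanishing mean curvature says
  that \<open>h\<close> is traceless.\<close>

lemma second_fundamental_form_zero: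
  assumes u: "u \<in> S"
    and semi: "\<And>x y z w. curvature_action \<kappa> F (\<lambda>_. x) (\<lambda>_. y) (\<lambda>_. z) (\<lambda>_. w) u = 0"
    and mean: "mean_curvature \<kappa> F u = 0"
  shows "II u x y = 0"
proof (rule ccontr)
  let ?g = "induced_metric F u"
  define \<nu> where "\<nu> = II u x y"
  assume "II u x y \<noteq> 0"
  then have \<nu>: "\<nu> \<in> normal_space F u" "\<nu> \<noteq> 0"
    by (simp_all add: \<nu>_def II_normal[OF u])
  define q where "q = lorentz \<nu> \<nu>"
  have q: "q < 0"
    unfolding q_def by (rule normal_timelike[OF u \<nu>])
  define h where "h = (\<lambda>x y. lorentz \<nu> (II u x y) / q)"
  have II_h: "II u x y = h x y *\<^sub>R \<nu>" for x y
  proof (rule normal_space_eqI[OF u \<nu> II_normal[OF u]])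
    show "h x y *\<^sub>R \<nu> \<in> normal_space F u"
      using \<nu>(1) by (simp add: normal_space_def lorentz.scaleR_left)
    show "lorentz \<nu> (II u x y) = lorentz \<nu> (h x y *\<^sub>R \<nu>)"
      using q by (simp add: h_def lorentz.scaleR_right flip: q_def)
  qed
  have h_sym: "h x y = h y x" for x y
    by (simp add: h_def II_commute[OF u, of x])
  have g_sym: "?g x y = ?g y x" for x y
    by (simp add: induced_metric_def lorentz_commute)
  have h_lin: "linear (\<lambda>x. h x y)" for y
    unfolding h_def
    by (rule linearI) (simp_all add: bilinear_ladd[OF bilinear_lorentz_II[OF u]]
        bilinear_lmul[OF bilinear_lorentz_II[OF u]] add_divide_distrib)
  \<comment> \<open>the basis that the definition of the mean curvature chooses, so that no independence of the
    trace from the basis has to be shown\<close>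
  define B where "B = (SOME B. orthonormal_basis F u B)"
  have "\<exists>B. orthonormal_basis F u B"
    unfolding orthonormal_basis_def
    using exists_orthonormal_basis[OF bilinear_metric[OF u] g_sym metric_pos[OF u]] by simp
  then have "orthonormal_basis F u B"
    unfolding B_def by (rule someI_ex)
  then have B: "finite B" "span B = UNIV"
    and orth: "\<And>b c. b \<in> B \<Longrightarrow> c \<in> B \<Longrightarrow> ?g b c = (if b = c then 1 else 0)"
    by (simp_all add: orthonormal_basis_def)
  have "B \<noteq> {}"
    using B(2) UNIV_not_singleton by auto
  have expand: "h v w = (\<Sum>b\<in>B. ?g v b * h b w)" for v w
    by (rule orthonormal_expansion[OF bilinear_metric[OF u] B orth h_lin])
  have "(\<Sum>b\<in>B. II u b b) = 0"
    using mean by (simp add: mean_curvature_def B_def second_fundamental_form_eq[OF _ u])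
  then have trace: "(\<Sum>b\<in>B. h b b) = 0"
    using \<nu>(2) by (simp add: II_h flip: scaleR_sum_left)
  define hsq where "hsq = (\<lambda>v w. \<Sum>b\<in>B. h v b * h b w)"
  let ?R = "\<lambda>x y z. curvature (levi_civita F) (\<lambda>_. x) (\<lambda>_. y) (\<lambda>_. z) u"
  have hR: "h (?R x y z) w = \<kappa> * (?g y z * h x w - ?g x z * h y w) + q * (h y z * hsq x w - h x z * hsq y w)"
    for x y z w
  proof -
    have "?g (?R x y z) b = \<kappa> * (?g y z * ?g x b - ?g x z * ?g y b) + q * (h y z * h x b - h x z * h y b)" for b
      by (simp add: gauss_equation[OF u] II_h lorentz.scaleR_left lorentz.scaleR_right algebra_simps
          flip: q_def)
    then have "h (?R x y z) w = (\<Sum>b\<in>B. (\<kappa> * (?g y z * ?g x b - ?g x z * ?g y b)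
        + q * (h y z * h x b - h x z * h y b)) * h b w)"
      using expand[of "?R x y z" w] by simp
    also have "\<dots> = \<kappa> * (?g y z * (\<Sum>b\<in>B. ?g x b * h b w) - ?g x z * (\<Sum>b\<in>B. ?g y b * h b w))
        + q * (h y z * hsq x w - h x z * hsq y w)"
      by (simp add: hsq_def sum_distrib_left sum.distrib sum_subtractf algebra_simps)
    finally show ?thesis
      by (simp flip: expand)
  qed
  have "h (?R x y z) w + h (?R x y w) z = 0" for x y z w
  proof -
    have "(h (?R x y z) w + h z (?R x y w)) *\<^sub>R \<nu>
        = - curvature_action \<kappa> F (\<lambda>_. x) (\<lambda>_. y) (\<lambda>_. z) (\<lambda>_. w) u"
      by (simp add: curvature_action_const[OF u] II_h scaleR_left_distrib)
    then have "h (?R x y z) w + h z (?R x y w) = 0"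
      using \<nu>(2) by (simp add: semi)
    then show ?thesis
      by (simp add: h_sym[of z])
  qed
  then have eq: "\<kappa> * (?g y z * h x w - ?g x z * h y w + ?g y w * h x z - ?g x w * h y z)
      + q * (h y z * hsq x w - h x z * hsq y w + h y w * hsq x z - h x w * hsq y z) = 0" for x y z w
    unfolding hR by (simp add: algebra_simps)
  have "h x y = 0"
    by (rule traceless_semi_symmetric_form_zero[where g = ?g and hsq = hsq and \<kappa> = \<kappa> and q = q,
          OF B(1) \<open>B \<noteq> {}\<close> g_sym h_sym expand _ _ trace \<kappa>_pos _ eq])
      (use orth q in \<open>auto simp: hsq_def\<close>)
  then show False
    using II_h[of x y] \<open>II u x y \<noteq> 0\<close> by simp
qed

end

section \<open>From charts to the manifold\<close>

theorem corollary6: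
  fixes M :: "'m topology"
    and \<A> :: "('m set \<times> ('m \<Rightarrow> 'e::euclidean_space)) set"
    and f :: "'m \<Rightarrow> real \<times> 'b::euclidean_space"
    and \<kappa> :: real
  assumes "\<kappa> > 0"
    and "DIM('b) = DIM('e) + 1"
    and "smooth_manifold M \<A>"
    and "spacelike_immersion_de_sitter \<kappa> M \<A> f"
    and "semi_parallel \<kappa> \<A> f"
    and "extremal \<kappa> \<A> f"
  shows "totally_geodesic \<kappa> \<A> f"
proof -
  have "second_fundamental_form \<kappa> (local_rep U \<phi> f) X Y u = 0"
    if chart: "(U, \<phi>) \<in> \<A>" and X: "smooth_on (\<phi> ` U) X" and Y: "smooth_on (\<phi> ` U) Y" and u: "u \<in> \<phi> ` U"
    for U \<phi> X Y u
  proof -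
    let ?F = "local_rep U \<phi> f"
    have U: "U \<subseteq> topspace M" and "open (\<phi> ` U)"
      using assms(3) chart openin_subset by (fastforce simp: smooth_manifold_def)+
    have into: "f \<in> topspace M \<rightarrow> de_sitter \<kappa>" and smooth: "smooth_on (\<phi> ` U) ?F"
      and pos: "\<And>p v. p \<in> \<phi> ` U \<Longrightarrow> v \<noteq> 0 \<Longrightarrow> 0 < induced_metric ?F p v v"
      using assms(4) chart
      by (auto simp: spacelike_immersion_de_sitter_def smooth_map_into_def spacelike_def)
    have "lorentz (?F p) (?F p) = 1 / \<kappa>" if "p \<in> \<phi> ` U" for p
    proof -
      have "?F p \<in> de_sitter \<kappa>"
        using into U inv_into_into[OF that] by (auto simp: local_rep_def)
      then show ?thesis
        by (simp add: de_sitter_def)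
    qed
    then interpret spacelike_hypersurface_patch "\<phi> ` U" \<kappa> ?F
      using assms(1,2) \<open>open (\<phi> ` U)\<close> smooth pos by unfold_locales
    have "II u (X u) (Y u) = 0"
      using assms(5,6) chart u
      by (intro second_fundamental_form_zero[OF u]) (auto simp: semi_parallel_def extremal_def)
    then show ?thesis
      by (simp add: second_fundamental_form_eq[OF Y u])
  qed
  then show ?thesis
    by (auto simp: totally_geodesic_def)
qed

end
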